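(* Let $A$ be a pointed topological space, let $X$ and $Y$ be $CW(A)$-complexes and let $f:X\to Y$ be a continuous (pointed) map. Then $f$ is a homotopy equivalence if and only if it is an $A$-weak equivalence.
   Context: All spaces are pointed, all maps are pointed, and homotopies preserve base points. $\mathrm{C}X$ is the reduced cone, $\Sigma X$ the reduced suspension, $\Sigma^0A=A$. For $n\ge 1$, $X$ is obtained from a pointed space $Z$ by attaching $n$-cells of type $A$ if $X$ is a pushout of $Z\xleftarrow{\,g\,}\bigvee_{\alpha\in J}\Sigma^{n-1}A\xrightarrow{\,i\,}\bigvee_{\alpha\in J}\mathrm{C}\Sigma^{n-1}A$ for some index set $J$ and some map $g$, where $i$ is the wedge of the inclusions as bases of the cones. $X$ is obtained from $Z$ by attaching $0$-cells of type $A$ if $X=Z\vee\bigvee_{\alpha\in J}A$. A $CW(A)$-complex is a space $X$ that is the colimit of a sequence $*=X^{-1}\to X^0\to X^1\to\cdots$ such that, for all $n\ge 0$, $X^n$ is obtained from $X^{n-1}$ by attaching $n$-cells of type $A$. For $r\ge 0$, $\pi_r^A(X)=[\Sigma^rA,X]$ is the set of pointed homotopy classes of pointed maps (a group for $r\ge 1$). For $n\in\mathbb{N}$ (that is, $n\geq 1$), $f:X\to Y$ is an $A$-$n$-equivalence if $f_*:\pi_r^A(X)\to\pi_r^A(Y)$ is an isomorphism (a bijection when $r=0$) for $0\le r<n$ and an epimorphism for $r=n$. The map $f$ is an $A$-weak equivalence if it is an $A$-$n$-equivalence for all $n\in\mathbb{N}$. *)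

theory Defs
  imports "HOL-Analysis.Analysis" "HOL-Algebra.Group"
begin

section \<open>Pointed spaces, pointed maps, pointed homotopies\<close>

type_synonym 'a pointed = "'a topology \<times> 'a"

abbreviation spc :: "'a pointed \<Rightarrow> 'a topology" where "spc \<equiv> fst"
abbreviation bpt :: "'a pointed \<Rightarrow> 'a" where "bpt \<equiv> snd"

definition pointed_space :: "'a pointed \<Rightarrow> bool" where
  "pointed_space X \<longleftrightarrow> bpt X \<in> topspace (spc X)"

definition pmap :: "'a pointed \<Rightarrow> 'b pointed \<Rightarrow> ('a \<Rightarrow> 'b) \<Rightarrow> bool" where
  "pmap X Y f \<longleftrightarrow> continuous_map (spc X) (spc Y) f \<and> f (bpt X) = bpt Y"

definition phomotopic :: "'a pointed \<Rightarrow> 'b pointed \<Rightarrow> ('a \<Rightarrow> 'b) \<Rightarrow> ('a \<Rightarrow> 'b) \<Rightarrow> bool" where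
  "phomotopic X Y f g \<longleftrightarrow> homotopic_with (\<lambda>h. h (bpt X) = bpt Y) (spc X) (spc Y) f g"

definition phomotopy_equivalence :: "'a pointed \<Rightarrow> 'b pointed \<Rightarrow> ('a \<Rightarrow> 'b) \<Rightarrow> bool" where
  "phomotopy_equivalence X Y f \<longleftrightarrow> pmap X Y f \<and>
     (\<exists>g. pmap Y X g \<and> phomotopic X X (g \<circ> f) id \<and> phomotopic Y Y (f \<circ> g) id)"

definition point_space :: "unit pointed" where
  "point_space = (discrete_topology UNIV, ())"


section \<open>Quotients\<close>

text \<open>The finest topology on the set \<open>S\<close> that makes \<open>q\<close> continuous (where \<open>q\<close> maps \<open>Y\<close> into \<open>S\<close>).
  The set \<open>S\<close> is a separate argument because a wedge over the empty index set has a point that is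
  not in the image of \<open>q\<close>.\<close>

definition final_topology :: "'a topology \<Rightarrow> 'b set \<Rightarrow> ('a \<Rightarrow> 'b) \<Rightarrow> 'b topology" where
  "final_topology Y S q =
     topology (\<lambda>U. U \<subseteq> S \<and> openin Y {y \<in> topspace Y. q y \<in> U})"

lemma istopology_final:
  "istopology (\<lambda>U. U \<subseteq> S \<and> openin Y {y \<in> topspace Y. q y \<in> U})"
proof -
  have 1: "{y \<in> topspace Y. q y \<in> U \<inter> V} = {y \<in> topspace Y. q y \<in> U} \<inter> {y \<in> topspace Y. q y \<in> V}"
    for U V by auto
  have 2: "{y \<in> topspace Y. q y \<in> \<Union>K} = (\<Union>U\<in>K. {y \<in> topspace Y. q y \<in> U})" for K by auto
  show ?thesis
    unfolding istopology_def 1 2 by blast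
qed

lemma openin_final_topology:
  "openin (final_topology Y S q) U \<longleftrightarrow> U \<subseteq> S \<and> openin Y {y \<in> topspace Y. q y \<in> U}"
  by (simp add: final_topology_def istopology_final)

lemma topspace_final_topology:
  assumes "q ` topspace Y \<subseteq> S"
  shows "topspace (final_topology Y S q) = S"
proof -
  have "{y \<in> topspace Y. q y \<in> S} = topspace Y" using assms by auto
  then have "openin (final_topology Y S q) S" by (simp add: openin_final_topology)
  then show ?thesis
    by (meson openin_final_topology openin_subset openin_topspace subset_antisym)
qed

lemma quotient_map_final_topology:
  assumes "q ` topspace Y = S"
  shows "quotient_map Y (final_topology Y S q) q"
  using assms by (auto simp: quotient_map_def topspace_final_topology openin_final_topology)

text \<open>\<open>X\<close> is the quotient of \<open>Y\<close> by the equivalence relation generated by \<open>r\<close>, with projection \<open>q\<close>.\<close>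

definition is_quotient_by ::
    "'a topology \<Rightarrow> ('a \<Rightarrow> 'a \<Rightarrow> bool) \<Rightarrow> 'b topology \<Rightarrow> ('a \<Rightarrow> 'b) \<Rightarrow> bool" where
  "is_quotient_by Y r X q \<longleftrightarrow> quotient_map Y X q \<and>
     (\<forall>y\<in>topspace Y. \<forall>y'\<in>topspace Y. q y = q y' \<longleftrightarrow> equivclp r y y')"

lemma is_quotient_by_lift:
  assumes q: "is_quotient_by Y r X q" and h: "continuous_map Y W h"
    and r: "\<And>y y'. r y y' \<Longrightarrow> h y = h y'"
  shows "\<exists>k. continuous_map X W k \<and> (\<forall>y\<in>topspace Y. k (q y) = h y)"
proof -
  have "h y = h y'" if "equivclp r y y'" for y y'
    using that by (induction rule: equivclp_induct) (auto dest: r)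
  then have eq: "h y = h y'" if "y \<in> topspace Y" "y' \<in> topspace Y" "q y = q y'" for y y'
    using q that unfolding is_quotient_by_def by blast
  have "quotient_map Y X q" using q by (simp add: is_quotient_by_def)
  then obtain k where "continuous_map X W k" "\<And>y. y \<in> topspace Y \<Longrightarrow> k (q y) = h y"
    by (rule quotient_map_lift_exists[OF _ h]) (blast intro: eq)+
  then show ?thesis by blast
qed


section \<open>Pushouts and sequential colimits\<close>

definition sum2_topology :: "'a topology \<Rightarrow> 'b topology \<Rightarrow> ('a + 'b) topology" where
  "sum2_topology Z V =
     topology (\<lambda>U. U \<subseteq> topspace Z <+> topspace V \<and> openin Z (Inl -` U) \<and> openin V (Inr -` U))"

lemma openin_sum2_topology:
  "openin (sum2_topology Z V) U \<longleftrightarrow>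
     U \<subseteq> topspace Z <+> topspace V \<and> openin Z (Inl -` U) \<and> openin V (Inr -` U)"
proof -
  have "istopology (\<lambda>U. U \<subseteq> topspace Z <+> topspace V \<and> openin Z (Inl -` U) \<and> openin V (Inr -` U))"
    unfolding istopology_def vimage_Int vimage_Union by blast
  then show ?thesis by (simp add: sum2_topology_def)
qed

lemma topspace_sum2_topology [simp]:
  "topspace (sum2_topology Z V) = topspace Z <+> topspace V"
proof -
  have "openin (sum2_topology Z V) (topspace Z <+> topspace V)"
    by (simp add: openin_sum2_topology Plus_def vimage_Un inj_vimage_image_eq)
       (simp add: vimage_def image_iff)
  then show ?thesis
    by (meson openin_sum2_topology openin_subset openin_topspace subset_antisym)
qed

definition pushout_rel ::
    "'u pointed \<Rightarrow> ('u \<Rightarrow> 'z) \<Rightarrow> ('u \<Rightarrow> 'v) \<Rightarrow> 'z + 'v \<Rightarrow> 'z + 'v \<Rightarrow> bool" where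
  "pushout_rel U g i p q \<longleftrightarrow> (\<exists>u\<in>topspace (spc U). p = Inl (g u) \<and> q = Inr (i u))"

text \<open>The pointed space \<open>X\<close>, with the maps \<open>k : Z \<rightarrow> X\<close> and \<open>h : V \<rightarrow> X\<close>, is a pushout
  of \<open>Z \<leftarrow> U \<rightarrow> V\<close> (the two maps being \<open>g\<close> and \<open>i\<close>): up to homeomorphism, it is the quotient
  of the disjoint union of \<open>Z\<close> and \<open>V\<close> that glues \<open>g u\<close> to \<open>i u\<close> for all \<open>u\<close>.\<close>

definition is_pushout ::
    "'u pointed \<Rightarrow> 'z pointed \<Rightarrow> 'v pointed \<Rightarrow> ('u \<Rightarrow> 'z) \<Rightarrow> ('u \<Rightarrow> 'v) \<Rightarrow>
     'x pointed \<Rightarrow> ('z \<Rightarrow> 'x) \<Rightarrow> ('v \<Rightarrow> 'x) \<Rightarrow> bool" where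
  "is_pushout U Z V g i X k h \<longleftrightarrow>
     pmap U Z g \<and> pmap U V i \<and> pmap Z X k \<and> pmap V X h \<and>
     is_quotient_by (sum2_topology (spc Z) (spc V)) (pushout_rel U g i) (spc X) (case_sum k h)"

lemma is_pushout_universal:
  assumes po: "is_pushout U Z V g i X k h" and Z: "pointed_space Z"
    and a: "pmap Z W a" and b: "pmap V W b"
    and eq: "\<And>u. u \<in> topspace (spc U) \<Longrightarrow> a (g u) = b (i u)"
  shows "\<exists>c. pmap X W c \<and> (\<forall>z\<in>topspace (spc Z). c (k z) = a z) \<and> (\<forall>v\<in>topspace (spc V). c (h v) = b v)"
proof -
  let ?Y = "sum2_topology (spc Z) (spc V)"
  have cont: "continuous_map ?Y (spc W) (case_sum a b)"
    unfolding continuous_map_def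
  proof (intro conjI allI impI)
    show "case_sum a b \<in> topspace ?Y \<rightarrow> topspace (spc W)"
      using a b by (auto simp: pmap_def continuous_map_def Pi_iff)
    fix T assume T: "openin (spc W) T"
    have 1: "Inl -` {x \<in> topspace ?Y. case_sum a b x \<in> T} = {z \<in> topspace (spc Z). a z \<in> T}" by auto
    have 2: "Inr -` {x \<in> topspace ?Y. case_sum a b x \<in> T} = {v \<in> topspace (spc V). b v \<in> T}" by auto
    have 3: "{x \<in> topspace ?Y. case_sum a b x \<in> T} \<subseteq> topspace (spc Z) <+> topspace (spc V)" by auto
    show "openin ?Y {x \<in> topspace ?Y. case_sum a b x \<in> T}"
      unfolding openin_sum2_topology 1 2 using 3 a b T by (auto simp: pmap_def continuous_map_def)
  qed
  have rel: "case_sum a b p = case_sum a b q" if "pushout_rel U g i p q" for p q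
    using that eq by (auto simp: pushout_rel_def)
  have Q: "is_quotient_by ?Y (pushout_rel U g i) (spc X) (case_sum k h)"
    using po by (simp add: is_pushout_def)
  obtain c where c: "continuous_map (spc X) (spc W) c"
    and ceq: "\<forall>y\<in>topspace ?Y. c (case_sum k h y) = case_sum a b y"
    using is_quotient_by_lift[OF Q cont rel] by blast
  have cz: "c (k z) = a z" if "z \<in> topspace (spc Z)" for z
    using ceq[rule_format, of "Inl z"] that by auto
  have cv: "c (h v) = b v" if "v \<in> topspace (spc V)" for v
    using ceq[rule_format, of "Inr v"] that by auto
  have "c (bpt X) = bpt W"
    using cz[of "bpt Z"] Z po a by (auto simp: is_pushout_def pmap_def pointed_space_def)
  then show "\<exists>c. pmap X W c \<and> (\<forall>z\<in>topspace (spc Z). c (k z) = a z) \<and> (\<forall>v\<in>topspace (spc V). c (h v) = b v)"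
    using c cz cv by (auto simp: pmap_def)
qed

lemma is_pushout_unique:
  assumes po: "is_pushout U Z V g i X k h"
    and "\<forall>z\<in>topspace (spc Z). c (k z) = c' (k z)" "\<forall>v\<in>topspace (spc V). c (h v) = c' (h v)"
    and x: "x \<in> topspace (spc X)"
  shows "c x = c' x"
proof -
  have "x \<in> case_sum k h ` topspace (sum2_topology (spc Z) (spc V))"
    using po x by (simp add: is_pushout_def is_quotient_by_def quotient_map_def)
  then show ?thesis using assms by auto
qed

definition seq_colimit_rel ::
    "(nat \<Rightarrow> 's pointed) \<Rightarrow> (nat \<Rightarrow> 's \<Rightarrow> 's) \<Rightarrow> nat \<times> 's \<Rightarrow> nat \<times> 's \<Rightarrow> bool" where
  "seq_colimit_rel S k p q \<longleftrightarrow> (\<exists>n. \<exists>x\<in>topspace (spc (S n)). p = (n, x) \<and> q = (Suc n, k n x))"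

definition is_seq_colimit ::
    "(nat \<Rightarrow> 's pointed) \<Rightarrow> (nat \<Rightarrow> 's \<Rightarrow> 's) \<Rightarrow> 'x pointed \<Rightarrow> (nat \<Rightarrow> 's \<Rightarrow> 'x) \<Rightarrow> bool" where
  "is_seq_colimit S k X \<iota> \<longleftrightarrow>
     (\<forall>n. pmap (S n) (S (Suc n)) (k n)) \<and> (\<forall>n. pmap (S n) X (\<iota> n)) \<and>
     is_quotient_by (sum_topology (\<lambda>n. spc (S n)) UNIV) (seq_colimit_rel S k) (spc X)
       (\<lambda>(n, x). \<iota> n x)"


section \<open>Wedges\<close>

text \<open>The wedge of copies of \<open>B\<close> indexed by \<open>J\<close> has the points \<open>None\<close> (the base point) and
  \<open>Some (\<alpha>, b)\<close> for \<open>\<alpha> \<in> J\<close> and \<open>b\<close> different from the base point of \<open>B\<close>.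
  It is a single point if \<open>J\<close> is empty.\<close>

definition wedge_proj :: "'b pointed \<Rightarrow> 'j \<times> 'b \<Rightarrow> ('j \<times> 'b) option" where
  "wedge_proj B p = (if snd p = bpt B then None else Some p)"

definition wedge :: "'j set \<Rightarrow> 'b pointed \<Rightarrow> ('j \<times> 'b) option pointed" where
  "wedge J B =
     (final_topology (sum_topology (\<lambda>_. spc B) J)
        (insert None (wedge_proj B ` (J \<times> topspace (spc B)))) (wedge_proj B), None)"

definition wedge_map :: "'c pointed \<Rightarrow> ('b \<Rightarrow> 'c) \<Rightarrow> ('j \<times> 'b) option \<Rightarrow> ('j \<times> 'c) option" where
  "wedge_map C f p = (case p of None \<Rightarrow> None | Some (\<alpha>, b) \<Rightarrow> wedge_proj C (\<alpha>, f b))"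


section \<open>Reduced cones and suspensions\<close>

text \<open>A type that contains the points of all spaces obtained from a space of type \<open>'a\<close> by iterating
  cones and suspensions: \<open>Emb a\<close> is a point of the original space, \<open>Star\<close> is the base point
  of a reduced cone or suspension and \<open>Cyl x t\<close> is the class of \<open>(x, t)\<close> when this
  is not the base point.\<close>

datatype 'a cyl = Star | Emb 'a | Cyl "'a cyl" real

abbreviation cylinder :: "'a topology \<Rightarrow> ('a \<times> real) topology" where
  "cylinder Y \<equiv> prod_topology Y (top_of_set {0..1})"

text \<open>The reduced cone: the base is at \<open>t = 0\<close> and the vertex at \<open>t = 1\<close>.\<close>

definition cone_proj :: "'a cyl pointed \<Rightarrow> 'a cyl \<times> real \<Rightarrow> 'a cyl" where
  "cone_proj X = (\<lambda>(x, t). if x = bpt X \<or> t = 1 then Star else Cyl x t)"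

definition cone :: "'a cyl pointed \<Rightarrow> 'a cyl pointed" where
  "cone X = (final_topology (cylinder (spc X)) (cone_proj X ` topspace (cylinder (spc X)))
               (cone_proj X), Star)"

definition cone_base :: "'a cyl pointed \<Rightarrow> 'a cyl \<Rightarrow> 'a cyl" where
  "cone_base X x = cone_proj X (x, 0)"

definition susp_proj :: "'a cyl pointed \<Rightarrow> 'a cyl \<times> real \<Rightarrow> 'a cyl" where
  "susp_proj X = (\<lambda>(x, t). if x = bpt X \<or> t = 0 \<or> t = 1 then Star else Cyl x t)"

definition susp :: "'a cyl pointed \<Rightarrow> 'a cyl pointed" where
  "susp X = (final_topology (cylinder (spc X)) (susp_proj X ` topspace (cylinder (spc X)))
               (susp_proj X), Star)"

text \<open>The copy of \<open>A\<close> in the type \<open>'a cyl\<close>; the injective map \<open>Emb\<close> is a homeomorphism onto it.\<close>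

definition embed :: "'a pointed \<Rightarrow> 'a cyl pointed" where
  "embed A = (final_topology (spc A) (Emb ` topspace (spc A)) Emb, Emb (bpt A))"

primrec Sigma_pow :: "nat \<Rightarrow> 'a pointed \<Rightarrow> 'a cyl pointed" where
  "Sigma_pow 0 A = embed A"
| "Sigma_pow (Suc n) A = susp (Sigma_pow n A)"


section \<open>\<open>CW(A)\<close>-complexes\<close>

text \<open>\<open>X\<close> is obtained from \<open>Z\<close> by attaching \<open>n\<close>-cells of type \<open>A\<close>, and \<open>k : Z \<rightarrow> X\<close> is the
  canonical map. The wedge of \<open>Z\<close> and \<open>W\<close> is the pushout of \<open>Z\<close> and \<open>W\<close> over
  a point. The type \<open>'j\<close> is the one over which the index set ranges.\<close>

definition attach_cells ::
    "'j itself \<Rightarrow> nat \<Rightarrow> 'a pointed \<Rightarrow> 'z pointed \<Rightarrow> 'x pointed \<Rightarrow> ('z \<Rightarrow> 'x) \<Rightarrow> bool" where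
  "attach_cells _ n A Z X k \<longleftrightarrow>
     (if n = 0 then
        (\<exists>(J :: 'j set) h.
           is_pushout point_space Z (wedge J A) (\<lambda>_. bpt Z) (\<lambda>_. None) X k h)
      else
        (\<exists>(J :: 'j set) g h.
           is_pushout (wedge J (Sigma_pow (n - 1) A)) Z (wedge J (cone (Sigma_pow (n - 1) A)))
             g (wedge_map (cone (Sigma_pow (n - 1) A)) (cone_base (Sigma_pow (n - 1) A))) X k h))"

text \<open>The space \<open>X\<^sup>n\<close> is \<open>S (n + 1)\<close>, so that \<open>S 0\<close> is the one-point space.
  A definition cannot quantify over types, so the type \<open>'j\<close> of the index sets and the type \<open>'s\<close>
  of the points of the spaces \<open>X\<^sup>n\<close> are parameters; they are arbitrary.\<close>

definition CW_complex :: "'j itself \<Rightarrow> 's itself \<Rightarrow> 'a pointed \<Rightarrow> 'x pointed \<Rightarrow> bool" where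
  "CW_complex TJ _ A X \<longleftrightarrow> pointed_space X \<and>
     (\<exists>(S :: nat \<Rightarrow> 's pointed) k \<iota>.
        topspace (spc (S 0)) = {bpt (S 0)} \<and>
        (\<forall>n. attach_cells TJ n A (S n) (S (Suc n)) (k n)) \<and>
        is_seq_colimit S k X \<iota>)"


section \<open>Homotopy groups with coefficients and \<open>A\<close>-weak equivalences\<close>

definition pclasses :: "'b pointed \<Rightarrow> 'x pointed \<Rightarrow> ('b \<Rightarrow> 'x) set set" where
  "pclasses B X = {u. pmap B X u} // {(u, v). phomotopic B X u v}"

definition pi_set :: "nat \<Rightarrow> 'a pointed \<Rightarrow> 'x pointed \<Rightarrow> ('a cyl \<Rightarrow> 'x) set set" where
  "pi_set r A X = pclasses (Sigma_pow r A) X"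

definition susp_concat ::
    "'a cyl pointed \<Rightarrow> 'x pointed \<Rightarrow> ('a cyl \<Rightarrow> 'x) \<Rightarrow> ('a cyl \<Rightarrow> 'x) \<Rightarrow> 'a cyl \<Rightarrow> 'x" where
  "susp_concat B X u v p =
     (case p of
        Cyl x t \<Rightarrow> if t \<le> 1/2 then u (susp_proj B (x, 2 * t)) else v (susp_proj B (x, 2 * t - 1))
      | _ \<Rightarrow> bpt X)"

text \<open>The group of pointed homotopy classes of maps from the suspension of \<open>B\<close> to \<open>X\<close>.\<close>

definition susp_group :: "'a cyl pointed \<Rightarrow> 'x pointed \<Rightarrow> ('a cyl \<Rightarrow> 'x) set monoid" where
  "susp_group B X =
     \<lparr>carrier = pclasses (susp B) X,
      mult = (\<lambda>C D. {w. \<exists>u\<in>C. \<exists>v\<in>D. phomotopic (susp B) X (susp_concat B X u v) w}),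
      one = {w. phomotopic (susp B) X (\<lambda>_. bpt X) w}\<rparr>"

text \<open>Only meaningful for \<open>r \<ge> 1\<close>; its carrier is then \<open>pi_set r A X\<close>.\<close>

definition pi_group :: "nat \<Rightarrow> 'a pointed \<Rightarrow> 'x pointed \<Rightarrow> ('a cyl \<Rightarrow> 'x) set monoid" where
  "pi_group r A X = susp_group (Sigma_pow (r - 1) A) X"

lemma carrier_pi_group: "r \<ge> 1 \<Longrightarrow> carrier (pi_group r A X) = pi_set r A X"
  by (cases r) (simp_all add: pi_group_def susp_group_def pi_set_def)

definition pi_map ::
    "nat \<Rightarrow> 'a pointed \<Rightarrow> 'y pointed \<Rightarrow> ('x \<Rightarrow> 'y) \<Rightarrow> ('a cyl \<Rightarrow> 'x) set \<Rightarrow> ('a cyl \<Rightarrow> 'y) set" where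
  "pi_map r A Y f C = {w. \<exists>u\<in>C. phomotopic (Sigma_pow r A) Y (f \<circ> u) w}"

definition A_n_equivalence ::
    "nat \<Rightarrow> 'a pointed \<Rightarrow> 'x pointed \<Rightarrow> 'y pointed \<Rightarrow> ('x \<Rightarrow> 'y) \<Rightarrow> bool" where
  "A_n_equivalence n A X Y f \<longleftrightarrow> n \<ge> 1 \<and>
     bij_betw (pi_map 0 A Y f) (pi_set 0 A X) (pi_set 0 A Y) \<and>
     (\<forall>r. 1 \<le> r \<and> r < n \<longrightarrow> pi_map r A Y f \<in> iso (pi_group r A X) (pi_group r A Y)) \<and>
     pi_map n A Y f \<in> epi (pi_group n A X) (pi_group n A Y)"

definition A_weak_equivalence ::
    "'a pointed \<Rightarrow> 'x pointed \<Rightarrow> 'y pointed \<Rightarrow> ('x \<Rightarrow> 'y) \<Rightarrow> bool" where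
  "A_weak_equivalence A X Y f \<longleftrightarrow> (\<forall>n\<ge>1. A_n_equivalence n A X Y f)"

end

(* A pointed homotopy of maps into Y is a pointed map into the path space of Y, so the homotopy
   extension and lifting property of f : X -> Y is the strict right lifting property of the end point
   map p from the mapping path space of f to Y. Unlike a statement about homotopies, it is preserved by
   wedges, pushouts and sequential colimits by their universal properties alone, without any
   product of a quotient map with an interval. If f induces bijections on all homotopy sets with
   coefficients in A, then p lifts against * -> A and against the base inclusion of every cone on an
   iterated suspension of A, hence against * -> W for every CW(A)-complex W. Lifting the identity of Y
   gives a right homotopy inverse g of f; as g is again bijective on homotopy sets, it has a right
   homotopy inverse too, and f is a homotopy equivalence. *)

theory Submission
  imports Defs
begin

text \<open>Lifts over different cells can be glued only if they agree exactly on the common part. A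
  square that commutes up to homotopy would require coherent choices of homotopies at every stage;
  making the homotopy part of a point of the mapping path space turns this into strict
  commutativity. Bijectivity enters the cell step through two neighbouring degrees. Over a cone on
  the \<open>r\<close>-fold suspension of \<open>A\<close>, injectivity in degree \<open>r\<close>
  is used only at the trivial class, which also makes sense for \<open>r = 0\<close>, where there is
  no group structure. It provides some contraction in the source, but its image need not match the
  prescribed cone in \<open>Y\<close>. The discrepancy is a map on the suspension, so a class in
  degree \<open>r + 1\<close>, and surjectivity there corrects it: pinching a cone in the middle
  lets a map on the suspension be added to a contraction without changing its base.\<close>

section \<open>Clamping and pasting real parameters\<close>

text \<open>Retraction of the line onto the unit interval. Composing with it extends homotopies and
  maps on cylinders to the whole line, where paths live.\<close>

definition to_unit :: "real \<Rightarrow> real" where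
  "to_unit t = max 0 (min 1 t)"

lemma to_unit_bounds [simp]: "0 \<le> to_unit t" "to_unit t \<le> 1"
  by (auto simp: to_unit_def)

lemma to_unit_id [simp]: "0 \<le> t \<Longrightarrow> t \<le> 1 \<Longrightarrow> to_unit t = t"
  by (auto simp: to_unit_def)

lemma to_unit_le_0: "t \<le> 0 \<Longrightarrow> to_unit t = 0"
  by (auto simp: to_unit_def)

lemma continuous_map_to_unit [continuous_intros]:
  "continuous_map X euclideanreal \<phi> \<Longrightarrow> continuous_map X euclideanreal (\<lambda>z. to_unit (\<phi> z))"
  unfolding to_unit_def by (simp add: continuous_map_real_max continuous_map_real_min)

lemma continuous_map_paste:
  fixes p :: "'a \<Rightarrow> real"
  assumes p: "continuous_map X euclideanreal p" and f: "continuous_map X Y f" and g: "continuous_map X Y g"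
    and fg: "\<And>x. x \<in> topspace X \<Longrightarrow> p x = c \<Longrightarrow> f x = g x"
  shows "continuous_map X Y (\<lambda>x. if p x \<le> c then f x else g x)"
  by (rule continuous_map_cases_le[OF p _ continuous_map_from_subtopology[OF f]
        continuous_map_from_subtopology[OF g] fg]) simp_all

lemma continuous_map_compose_pair:
  assumes "continuous_map (prod_topology X Y) W (\<lambda>(x, y). u x y)"
    and "continuous_map Z X f" "continuous_map Z Y g"
  shows "continuous_map Z W (\<lambda>z. u (f z) (g z))"
proof -
  have "continuous_map Z (prod_topology X Y) (\<lambda>z. (f z, g z))"
    using assms by (intro continuous_map_pairedI)
  from continuous_map_compose[OF this assms(1)] show ?thesis
    by (simp add: o_def)
qed

lemma continuous_map_comp:
  assumes "continuous_map X Y f" "continuous_map Z X g"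
  shows "continuous_map Z Y (\<lambda>z. f (g z))"
  using continuous_map_compose[OF assms(2,1)] by (simp add: o_def)

section \<open>Pointed maps\<close>

lemma pmap_compose: "pmap X Y f \<Longrightarrow> pmap Y Z g \<Longrightarrow> pmap X Z (g \<circ> f)"
  by (auto simp: pmap_def intro: continuous_map_compose)

lemma pmap_comp: "pmap X Y f \<Longrightarrow> pmap Y Z g \<Longrightarrow> pmap X Z (\<lambda>x. g (f x))"
  using pmap_compose[of X Y f Z g] by (simp add: o_def)

lemma pmap_eq:
  assumes "pmap X Y f" "pointed_space X" "\<And>x. x \<in> topspace (spc X) \<Longrightarrow> f x = g x"
  shows "pmap X Y g"
  using assms continuous_map_eq[of "spc X" "spc Y" f g] by (simp add: pmap_def pointed_space_def)

lemma pmap_in: "pmap X Y f \<Longrightarrow> x \<in> topspace (spc X) \<Longrightarrow> f x \<in> topspace (spc Y)"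
  by (auto simp: pmap_def continuous_map_def)

lemma pointed_space_target: "pmap X Y f \<Longrightarrow> pointed_space X \<Longrightarrow> pointed_space Y"
  by (metis pmap_def pmap_in pointed_space_def)

lemma pmap_const: "pointed_space Y \<Longrightarrow> pmap X Y (\<lambda>_. bpt Y)"
  by (auto simp: pmap_def pointed_space_def)


section \<open>Path spaces\<close>

text \<open>Closed intervals serve as the compact sets of the subbase: they suffice for currying and
  for evaluation.\<close>

definition path_nbhd :: "'y topology \<Rightarrow> real \<Rightarrow> real \<Rightarrow> 'y set \<Rightarrow> (real \<Rightarrow> 'y) set" where
  "path_nbhd Y a b U = {\<gamma>. continuous_map euclideanreal Y \<gamma> \<and> \<gamma> ` {a..b} \<subseteq> U}"

text \<open>The compact-open topology. Paths are defined on the whole line, so that a path is determined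
  by its values as a HOL function.\<close>

definition path_space :: "'y topology \<Rightarrow> (real \<Rightarrow> 'y) topology" where
  "path_space Y = topology_generated_by {path_nbhd Y a b U | a b U. openin Y U}"

lemma topspace_path_space: "topspace (path_space Y) = {\<gamma>. continuous_map euclideanreal Y \<gamma>}"
proof -
  \<comment> \<open>The interval from 1 to 0 is empty, so this subbasic set contains every
    path.\<close>
  have "path_nbhd Y 1 0 (topspace Y) = {\<gamma>. continuous_map euclideanreal Y \<gamma>}"
    by (auto simp: path_nbhd_def)
  moreover have "path_nbhd Y a b U \<subseteq> {\<gamma>. continuous_map euclideanreal Y \<gamma>}" for a b U
    by (auto simp: path_nbhd_def)
  moreover have "openin Y (topspace Y)" by simp
  ultimately show ?thesis
    unfolding path_space_def topology_generated_by_topspace by blast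
qed

text \<open>Half of the exponential law. Since \<open>{a..b}\<close> is compact, the tube lemma
  yields one neighbourhood of \<open>z\<close> that works for the whole interval.\<close>

lemma continuous_map_curry:
  assumes H: "continuous_map (prod_topology Z euclideanreal) Y (\<lambda>(z, t). H z t)"
  shows "continuous_map Z (path_space Y) H"
  unfolding path_space_def
proof (rule continuous_on_generated_topo)
  have path: "continuous_map euclideanreal Y (H z)" if "z \<in> topspace Z" for z
    using continuous_map_compose_pair[OF H, of euclideanreal "\<lambda>_. z" "\<lambda>t. t"] that by simp
  fix V assume "V \<in> {path_nbhd Y a b U | a b U. openin Y U}"
  then obtain a b U where V: "V = path_nbhd Y a b U" and U: "openin Y U" by blast
  let ?W = "{p \<in> topspace (prod_topology Z euclideanreal). (\<lambda>(z, t). H z t) p \<in> U}"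
  have W: "openin (prod_topology Z euclideanreal) ?W"
    using H U by (rule openin_continuous_map_preimage)
  show "openin Z (H -` V \<inter> topspace Z)"
  proof (subst openin_subopen, intro ballI)
    fix z assume z: "z \<in> H -` V \<inter> topspace Z"
    then have "{z} \<times> {a..b} \<subseteq> ?W" by (auto simp: V path_nbhd_def)
    then obtain N T where N: "openin Z N" "z \<in> N" "{a..b} \<subseteq> T" "N \<times> T \<subseteq> ?W"
      using tube_lemma_right[OF W, of "{a..b}" z] z by (auto simp: compactin_euclidean_iff)
    have "H y ` {a..b} \<subseteq> U" if "y \<in> N" for y
      using N that by fastforce
    then have "N \<subseteq> H -` V \<inter> topspace Z"
      using path openin_subset[OF N(1)] unfolding V path_nbhd_def by blast
    then show "\<exists>T. openin Z T \<and> z \<in> T \<and> T \<subseteq> H -` V \<inter> topspace Z"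
      using N by blast
  qed
next
  have "H z \<in> path_nbhd Y 1 0 (topspace Y)" if "z \<in> topspace Z" for z
    using continuous_map_compose_pair[OF H, of euclideanreal "\<lambda>_. z" "\<lambda>t. t"] that
    by (simp add: path_nbhd_def)
  moreover have "openin Y (topspace Y)" by simp
  ultimately show "H ` topspace Z \<subseteq> \<Union> {path_nbhd Y a b U | a b U. openin Y U}" by blast
qed

text \<open>The other half, by local compactness of the line: a closed interval around
  \<open>t\<close> that \<gamma> maps into \<open>U\<close> defines the neighbourhood of \<gamma>,
  and its interior that of \<open>t\<close>.\<close>

lemma continuous_map_path_eval:
  "continuous_map (prod_topology (path_space Y) euclideanreal) Y (\<lambda>(\<gamma>, t). \<gamma> t)"
  unfolding continuous_map_def
proof (intro conjI allI impI)
  show "(\<lambda>(\<gamma>, t). \<gamma> t) \<in> topspace (prod_topology (path_space Y) euclideanreal) \<rightarrow> topspace Y"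
    by (auto simp: topspace_path_space continuous_map_def)
  fix U assume U: "openin Y U"
  let ?W = "{p \<in> topspace (prod_topology (path_space Y) euclideanreal). (\<lambda>(\<gamma>, t). \<gamma> t) p \<in> U}"
  show "openin (prod_topology (path_space Y) euclideanreal) ?W"
  proof (subst openin_subopen, intro ballI)
    fix p assume p: "p \<in> ?W"
    obtain \<gamma> t where pe: "p = (\<gamma>, t)" by force
    have \<gamma>: "continuous_map euclideanreal Y \<gamma>" and \<gamma>t: "\<gamma> t \<in> U"
      using p by (auto simp: pe topspace_path_space)
    have "open {s. \<gamma> s \<in> U}"
      using openin_continuous_map_preimage[OF \<gamma> U] by simp
    then obtain e where e: "e > 0" "cball t e \<subseteq> {s. \<gamma> s \<in> U}"
      using \<gamma>t open_contains_cball[of "{s. \<gamma> s \<in> U}"] by auto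
    let ?N = "path_nbhd Y (t - e) (t + e) U" and ?T = "{t - e<..<t + e}"
    have N: "openin (path_space Y) ?N"
      unfolding path_space_def using U by (intro topology_generated_by_Basis) blast
    have sub: "?N \<times> ?T \<subseteq> ?W"
      by (auto simp: path_nbhd_def topspace_path_space)
    have "p \<in> ?N \<times> ?T"
      using e \<gamma> by (auto simp: pe path_nbhd_def cball_eq_atLeastAtMost)
    then show "\<exists>T. openin (prod_topology (path_space Y) euclideanreal) T \<and> p \<in> T \<and> T \<subseteq> ?W"
      using N sub by (intro exI[of _ "?N \<times> ?T"]) (simp add: openin_prod_Times_iff)
  qed
qed

lemma continuous_map_eval_comp:
  assumes "continuous_map Z (path_space Y) K" "continuous_map Z euclideanreal \<phi>"
  shows "continuous_map Z Y (\<lambda>z. K z (\<phi> z))"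
  using continuous_map_compose_pair[OF continuous_map_path_eval assms] .

definition ppath :: "'y pointed \<Rightarrow> (real \<Rightarrow> 'y) pointed" where
  "ppath Y = (path_space (spc Y), \<lambda>_. bpt Y)"

section \<open>Pointed homotopies as maps into the path space\<close>

lemma phomotopic_refl: "pmap B Y u \<Longrightarrow> phomotopic B Y u u"
  by (simp add: phomotopic_def pmap_def)

lemma phomotopic_sym: "phomotopic B Y u v \<Longrightarrow> phomotopic B Y v u"
  unfolding phomotopic_def by (rule homotopic_with_symD)

lemma phomotopic_trans: "phomotopic B Y u v \<Longrightarrow> phomotopic B Y v w \<Longrightarrow> phomotopic B Y u w"
  unfolding phomotopic_def by (rule homotopic_with_trans)

lemma phomotopic_compose_left:
  assumes "phomotopic B Y u v" "pmap Y Z f"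
  shows "phomotopic B Z (f \<circ> u) (f \<circ> v)"
  unfolding phomotopic_def
  by (rule homotopic_with_compose_continuous_map_left[OF assms(1)[unfolded phomotopic_def]])
     (use assms(2) in \<open>simp_all add: pmap_def\<close>)

lemma phomotopic_compose_right:
  assumes "phomotopic B Y u v" "pmap C B h"
  shows "phomotopic C Y (u \<circ> h) (v \<circ> h)"
  unfolding phomotopic_def
  by (rule homotopic_with_compose_continuous_map_right[OF assms(1)[unfolded phomotopic_def]])
     (use assms(2) in \<open>simp_all add: pmap_def\<close>)

lemma phomotopicI:
  assumes B: "pointed_space B" and K: "pmap B (ppath Y) K"
    and 0: "\<And>x. x \<in> topspace (spc B) \<Longrightarrow> K x 0 = u x"
    and 1: "\<And>x. x \<in> topspace (spc B) \<Longrightarrow> K x 1 = v x"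
  shows "phomotopic B Y u v"
proof -
  have "continuous_map (prod_topology (top_of_set {0..1::real}) (spc B)) (spc Y) (\<lambda>p. K (snd p) (fst p))"
  proof (rule continuous_map_eval_comp)
    have "continuous_map (spc B) (path_space (spc Y)) K"
      using K by (simp add: pmap_def ppath_def)
    then show "continuous_map (prod_topology (top_of_set {0..1::real}) (spc B)) (path_space (spc Y)) (\<lambda>p. K (snd p))"
      by (rule continuous_map_comp) (rule continuous_map_snd)
    show "continuous_map (prod_topology (top_of_set {0..1::real}) (spc B)) euclideanreal fst"
      by (rule continuous_map_into_fulltopology[OF continuous_map_fst])
  qed
  moreover have "K (bpt B) t = bpt Y" for t
    using K by (simp add: pmap_def ppath_def)
  ultimately have "\<exists>h. continuous_map (prod_topology (top_of_set {0..1::real}) (spc B)) (spc Y) h \<and>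
      (\<forall>x\<in>topspace (spc B). h (0, x) = u x) \<and> (\<forall>x\<in>topspace (spc B). h (1, x) = v x) \<and>
      (\<forall>t\<in>{0..1}. h (t, bpt B) = bpt Y)"
    using 0 1 by - (rule exI[of _ "\<lambda>p. K (snd p) (fst p)"], simp)
  \<comment> \<open>Side condition of \<open>homotopic_with\<close>: the predicate may depend only
    on values on the space, which holds because the base point lies in it.\<close>
  moreover have "h (bpt B) = bpt Y \<longleftrightarrow> k (bpt B) = bpt Y"
    if "\<And>x. x \<in> topspace (spc B) \<Longrightarrow> h x = k x" for h k
    using that B by (simp add: pointed_space_def)
  ultimately show ?thesis
    unfolding phomotopic_def by (subst homotopic_with) blast+
qed

text \<open>The homotopy is extended to the line by clamping its parameter. The last conclusion is
  the constancy outside the unit interval that \<open>mapping_path\<close> demands.\<close>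

lemma phomotopicE:
  assumes "phomotopic B Y u v"
  obtains K where "pmap B (ppath Y) K" "\<And>x. K x 0 = u x" "\<And>x. K x 1 = v x"
    "\<And>x t. K x (to_unit t) = K x t"
proof -
  obtain h where h: "continuous_map (prod_topology (top_of_set {0..1::real}) (spc B)) (spc Y) h"
    "\<And>x. h (0, x) = u x" "\<And>x. h (1, x) = v x" "\<And>t. t \<in> {0..1} \<Longrightarrow> h (t, bpt B) = bpt Y"
    using assms unfolding phomotopic_def homotopic_with_def by blast
  let ?K = "\<lambda>x t. h (to_unit t, x)"
  have "continuous_map (spc B) (path_space (spc Y)) ?K"
  proof (rule continuous_map_curry)
    have "continuous_map (prod_topology (spc B) euclideanreal)
        (prod_topology (top_of_set {0..1::real}) (spc B)) (\<lambda>z. (to_unit (snd z), fst z))"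
    proof (rule continuous_map_pairedI)
      show "continuous_map (prod_topology (spc B) euclideanreal) (top_of_set {0..1::real}) (\<lambda>z. to_unit (snd z))"
        by (rule continuous_map_into_subtopology[OF continuous_map_to_unit[OF continuous_map_snd]]) auto
    qed (rule continuous_map_fst)
    from continuous_map_compose[OF this h(1)]
    show "continuous_map (prod_topology (spc B) euclideanreal) (spc Y) (\<lambda>(x, t). h (to_unit t, x))"
      by (simp add: o_def case_prod_unfold)
  qed
  moreover have "?K (bpt B) = (\<lambda>_. bpt Y)" using h(4) by auto
  ultimately have "pmap B (ppath Y) ?K" by (simp add: pmap_def ppath_def)
  then show thesis by (rule that) (simp_all add: h(2,3))
qed

section \<open>The lifting property\<close>

text \<open>Strict lifting of \<open>k\<close> against \<open>p\<close>: both triangles commute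
  exactly, but only on the spaces, since HOL functions are arbitrary elsewhere.\<close>

definition lifts ::
    "'z pointed \<Rightarrow> 'w pointed \<Rightarrow> ('z \<Rightarrow> 'w) \<Rightarrow> 'e pointed \<Rightarrow> 'y pointed \<Rightarrow> ('e \<Rightarrow> 'y) \<Rightarrow> bool" where
  "lifts Z W k E Y p \<longleftrightarrow>
     (\<forall>a b. pmap Z E a \<and> pmap W Y b \<and> (\<forall>z\<in>topspace (spc Z). b (k z) = p (a z)) \<longrightarrow>
        (\<exists>c. pmap W E c \<and> (\<forall>z\<in>topspace (spc Z). c (k z) = a z) \<and> (\<forall>w\<in>topspace (spc W). p (c w) = b w)))"

lemma liftsE:
  assumes "lifts Z W k E Y p" "pmap Z E a" "pmap W Y b" "\<And>z. z \<in> topspace (spc Z) \<Longrightarrow> b (k z) = p (a z)"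
  obtains c where "pmap W E c" "\<And>z. z \<in> topspace (spc Z) \<Longrightarrow> c (k z) = a z"
    "\<And>w. w \<in> topspace (spc W) \<Longrightarrow> p (c w) = b w"
  using assms unfolding lifts_def by metis

lemma liftsI:
  assumes "\<And>a b. \<lbrakk>pmap Z E a; pmap W Y b; \<And>z. z \<in> topspace (spc Z) \<Longrightarrow> b (k z) = p (a z)\<rbrakk> \<Longrightarrow>
    \<exists>c. pmap W E c \<and> (\<forall>z\<in>topspace (spc Z). c (k z) = a z) \<and> (\<forall>w\<in>topspace (spc W). p (c w) = b w)"
  shows "lifts Z W k E Y p"
  using assms unfolding lifts_def by blast

section \<open>Final topologies and wedges\<close>

lemma continuous_map_final_topology:
  assumes "q ` topspace Y \<subseteq> S"
  shows "continuous_map Y (final_topology Y S q) q"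
  using assms by (auto simp: continuous_map_def topspace_final_topology openin_final_topology)

lemma continuous_map_from_final_topology:
  assumes q: "q ` topspace Y \<subseteq> S" and c: "c ` S \<subseteq> topspace W"
    and cq: "continuous_map Y W (\<lambda>y. c (q y))"
  shows "continuous_map (final_topology Y S q) W c"
proof -
  have "{y \<in> topspace Y. q y \<in> {x \<in> S. c x \<in> U}} = {y \<in> topspace Y. c (q y) \<in> U}" for U
    using q by auto
  then show ?thesis
    using c cq by (auto simp: continuous_map_def topspace_final_topology[OF q] openin_final_topology)
qed

lemma continuous_map_from_sum_topology:
  assumes "\<And>i. i \<in> I \<Longrightarrow> continuous_map (X i) W (\<lambda>x. f (i, x))"
  shows "continuous_map (sum_topology X I) W f"
proof -
  have "{x. (i, x) \<in> Sigma I (topspace \<circ> X) \<and> f (i, x) \<in> U} = {x \<in> topspace (X i). f (i, x) \<in> U}"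
    if "i \<in> I" for i U using that by auto
  then show ?thesis
    using assms by (auto simp: continuous_map_def openin_sum_topology Pi_iff)
qed

lemma wedge_proj_image_subset:
  "wedge_proj B ` topspace (sum_topology (\<lambda>_. spc B) J) \<subseteq> insert None (wedge_proj B ` (J \<times> topspace (spc B)))"
  by auto

lemma topspace_wedge:
  "topspace (spc (wedge J B)) = insert None (wedge_proj B ` (J \<times> topspace (spc B)))"
  unfolding wedge_def by (simp add: topspace_final_topology[OF wedge_proj_image_subset])

lemma bpt_wedge [simp]: "bpt (wedge J B) = None"
  by (simp add: wedge_def)

lemma wedge_proj_bpt [simp]: "wedge_proj B (\<alpha>, bpt B) = None"
  by (simp add: wedge_proj_def)

lemma pmap_wedge_inclusion:
  assumes "\<alpha> \<in> J"
  shows "pmap B (wedge J B) (\<lambda>x. wedge_proj B (\<alpha>, x))"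
proof -
  have "continuous_map (sum_topology (\<lambda>_. spc B) J) (spc (wedge J B)) (wedge_proj B)"
    unfolding wedge_def using continuous_map_final_topology[OF wedge_proj_image_subset] by simp
  then show ?thesis
    using continuous_map_comp continuous_map_component_injection[OF assms, of "\<lambda>_. spc B"]
    by (fastforce simp: pmap_def)
qed

text \<open>That \<open>E\<close> is pointed gives \<open>None\<close> a legitimate image; for empty
  \<open>J\<close> no summand would provide it.\<close>

lemma wedge_universal:
  assumes E: "pointed_space E" and c: "\<And>\<alpha>. \<alpha> \<in> J \<Longrightarrow> pmap B E (c \<alpha>)"
  shows "\<exists>d. pmap (wedge J B) E d \<and>
    (\<forall>\<alpha>\<in>J. \<forall>x\<in>topspace (spc B). d (wedge_proj B (\<alpha>, x)) = c \<alpha> x)"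
proof -
  define d where "d = (\<lambda>p. case p of None \<Rightarrow> bpt E | Some (\<alpha>, x) \<Rightarrow> c \<alpha> x)"
  have d: "d (wedge_proj B (\<alpha>, x)) = c \<alpha> x" if "\<alpha> \<in> J" for \<alpha> x
    using c[OF that] by (auto simp: d_def wedge_proj_def pmap_def)
  have "continuous_map (sum_topology (\<lambda>_. spc B) J) (spc E) (\<lambda>y. d (wedge_proj B y))"
    by (rule continuous_map_from_sum_topology) (use c d in \<open>simp add: pmap_def\<close>)
  moreover have "d None \<in> topspace (spc E)"
    using E by (simp add: d_def pointed_space_def)
  then have "d ` (insert None (wedge_proj B ` (J \<times> topspace (spc B)))) \<subseteq> topspace (spc E)"
    using d pmap_in[OF c] by auto
  ultimately have "continuous_map (spc (wedge J B)) (spc E) d"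
    unfolding wedge_def fst_conv by (intro continuous_map_from_final_topology[OF wedge_proj_image_subset])
  then have "pmap (wedge J B) E d"
    by (simp add: pmap_def d_def)
  then show ?thesis using d by blast
qed

lemma wedge_map_proj:
  assumes "i (bpt B) = bpt C"
  shows "wedge_map C i (wedge_proj B (\<alpha>, x)) = wedge_proj C (\<alpha>, i x)"
  using assms by (auto simp: wedge_map_def wedge_proj_def)

lemma lifts_wedge:
  assumes i: "pmap B C i" and E: "pointed_space E" and p: "pmap E Y p" and L: "lifts B C i E Y p"
  shows "lifts (wedge J B) (wedge J C) (wedge_map C i) E Y p"
proof (rule liftsI)
  fix a b assume a: "pmap (wedge J B) E a" and b: "pmap (wedge J C) Y b"
    and ba: "\<And>z. z \<in> topspace (spc (wedge J B)) \<Longrightarrow> b (wedge_map C i z) = p (a z)"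
  have wm: "wedge_map C i (wedge_proj B (\<alpha>, x)) = wedge_proj C (\<alpha>, i x)" for \<alpha> x
    using i by (intro wedge_map_proj) (simp add: pmap_def)
  have "\<exists>c. pmap C E c \<and> (\<forall>x\<in>topspace (spc B). c (i x) = a (wedge_proj B (\<alpha>, x))) \<and>
      (\<forall>x\<in>topspace (spc C). p (c x) = b (wedge_proj C (\<alpha>, x)))" if "\<alpha> \<in> J" for \<alpha>
  proof -
    have "b (wedge_proj C (\<alpha>, i x)) = p (a (wedge_proj B (\<alpha>, x)))" if "x \<in> topspace (spc B)" for x
      using ba[of "wedge_proj B (\<alpha>, x)"] that \<open>\<alpha> \<in> J\<close> by (simp add: wm topspace_wedge)
    then show ?thesis
      using liftsE[OF L pmap_comp[OF pmap_wedge_inclusion[OF that] a]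
          pmap_comp[OF pmap_wedge_inclusion[OF that] b]] by metis
  qed
  \<comment> \<open>Choice of one lift for every summand.\<close>
  then obtain c where c: "\<And>\<alpha>. \<alpha> \<in> J \<Longrightarrow> pmap C E (c \<alpha>)"
    "\<And>\<alpha> x. \<alpha> \<in> J \<Longrightarrow> x \<in> topspace (spc B) \<Longrightarrow> c \<alpha> (i x) = a (wedge_proj B (\<alpha>, x))"
    "\<And>\<alpha> x. \<alpha> \<in> J \<Longrightarrow> x \<in> topspace (spc C) \<Longrightarrow> p (c \<alpha> x) = b (wedge_proj C (\<alpha>, x))"
    by metis
  obtain d where d: "pmap (wedge J C) E d"
    "\<And>\<alpha> x. \<alpha> \<in> J \<Longrightarrow> x \<in> topspace (spc C) \<Longrightarrow> d (wedge_proj C (\<alpha>, x)) = c \<alpha> x"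
    using wedge_universal[of E J C c, OF E c(1)] by blast
  have None: "d None = bpt E" "a None = bpt E" "b None = bpt Y" "p (bpt E) = bpt Y"
    using d(1) a b p by (auto simp: pmap_def)
  have "d (wedge_map C i z) = a z" if "z \<in> topspace (spc (wedge J B))" for z
    using that pmap_in[OF i] unfolding topspace_wedge
    by (auto simp: wm d(2) c(2) None) (simp add: wedge_map_def None)
  moreover have "p (d w) = b w" if "w \<in> topspace (spc (wedge J C))" for w
    using that unfolding topspace_wedge by (auto simp: d(2) c(3) None)
  ultimately show "\<exists>c. pmap (wedge J C) E c \<and>
      (\<forall>z\<in>topspace (spc (wedge J B)). c (wedge_map C i z) = a z) \<and>
      (\<forall>w\<in>topspace (spc (wedge J C)). p (c w) = b w)"
    using d(1) by blast
qed

text \<open>A wedge of one-point spaces is again a point, so this is an instance of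
  \<open>lifts_wedge\<close>.\<close>

lemma lifts_wedge_point:
  assumes A: "pointed_space A" and E: "pointed_space E" and p: "pmap E Y p"
    and L: "lifts point_space A (\<lambda>_. bpt A) E Y p"
  shows "lifts point_space (wedge J A) (\<lambda>_. None) E Y p"
proof (rule liftsI)
  have i: "pmap point_space A (\<lambda>_. bpt A)"
    using A by (rule pmap_const)
  fix a b assume a: "pmap point_space E a" and b: "pmap (wedge J A) Y b"
  have const: "pmap (wedge J point_space) E (\<lambda>_. bpt E)"
    using E by (rule pmap_const)
  have top: "topspace (spc (wedge J point_space)) = {None}"
    by (auto simp: topspace_wedge wedge_proj_def point_space_def)
  have "b (wedge_map A (\<lambda>_. bpt A) z) = p (bpt E)" if "z \<in> topspace (spc (wedge J point_space))" for z
    using that b p unfolding top by (simp add: wedge_map_def pmap_def)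
  from liftsE[OF lifts_wedge[OF i E p L] const b this] obtain c where c: "pmap (wedge J A) E c"
    "\<And>w. w \<in> topspace (spc (wedge J A)) \<Longrightarrow> p (c w) = b w" by metis
  have "c None = a z" for z
    using a c(1) by (simp add: pmap_def point_space_def)
  then show "\<exists>c. pmap (wedge J A) E c \<and> (\<forall>z\<in>topspace (spc point_space). c None = a z) \<and>
      (\<forall>w\<in>topspace (spc (wedge J A)). p (c w) = b w)"
    using c by blast
qed

section \<open>Pushouts and sequential colimits\<close>

lemma is_pushout_commutes:
  assumes po: "is_pushout U Z V g i X k h" and u: "u \<in> topspace (spc U)"
  shows "k (g u) = h (i u)"
proof -
  let ?Y = "sum2_topology (spc Z) (spc V)"
  have "Inl (g u) \<in> topspace ?Y" "Inr (i u) \<in> topspace ?Y"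
    using po pmap_in[OF _ u, of Z g] pmap_in[OF _ u, of V i] by (auto simp: is_pushout_def)
  moreover have "equivclp (pushout_rel U g i) (Inl (g u)) (Inr (i u))"
    using u by - (rule r_into_equivclp, auto simp: pushout_rel_def)
  ultimately have "case_sum k h (Inl (g u)) = case_sum k h (Inr (i u))"
    using po unfolding is_pushout_def is_quotient_by_def by blast
  then show ?thesis by simp
qed

text \<open>Cobase change: the lift over \<open>V\<close> and the given map on \<open>Z\<close> glue
  by the universal property. The triangle over \<open>Y\<close> can be tested on the images of
  \<open>Z\<close> and \<open>V\<close>, since these cover \<open>X\<close>.\<close>

lemma lifts_pushout:
  assumes po: "is_pushout U Z V g i X k h" and Z: "pointed_space Z" and L: "lifts U V i E Y p"
  shows "lifts Z X k E Y p"
proof (rule liftsI)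
  fix a b assume a: "pmap Z E a" and b: "pmap X Y b"
    and ba: "\<And>z. z \<in> topspace (spc Z) \<Longrightarrow> b (k z) = p (a z)"
  have maps: "pmap U Z g" "pmap U V i" "pmap Z X k" "pmap V X h"
    using po by (auto simp: is_pushout_def)
  have "b (h (i u)) = p (a (g u))" if "u \<in> topspace (spc U)" for u
    using is_pushout_commutes[OF po that] ba[OF pmap_in[OF maps(1) that]] by simp
  from liftsE[OF L pmap_comp[OF maps(1) a] pmap_comp[OF maps(4) b] this]
  obtain c where c: "pmap V E c" "\<And>u. u \<in> topspace (spc U) \<Longrightarrow> c (i u) = a (g u)"
    "\<And>v. v \<in> topspace (spc V) \<Longrightarrow> p (c v) = b (h v)" by blast
  obtain d where d: "pmap X E d" "\<forall>z\<in>topspace (spc Z). d (k z) = a z" "\<forall>v\<in>topspace (spc V). d (h v) = c v"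
    using is_pushout_universal[OF po Z a c(1)] c(2) by metis
  have "p (d x) = b x" if "x \<in> topspace (spc X)" for x
    using is_pushout_unique[OF po _ _ that, of "\<lambda>x. p (d x)" b] d ba c(3) by simp
  then show "\<exists>c. pmap X E c \<and> (\<forall>z\<in>topspace (spc Z). c (k z) = a z) \<and> (\<forall>w\<in>topspace (spc X). p (c w) = b w)"
    using d by blast
qed

text \<open>Each partial lift extends the previous one exactly, so the family is compatible with the
  colimit relation. It starts with the constant map because \<open>S 0\<close> is a point.\<close>

lemma lifts_seq_colimit:
  assumes col: "is_seq_colimit S k X \<iota>" and S0: "topspace (spc (S 0)) = {bpt (S 0)}"
    and E: "pointed_space E" and p: "pmap E Y p"
    and L: "\<And>n. lifts (S n) (S (Suc n)) (k n) E Y p" and b: "pmap X Y b"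
  obtains c where "pmap X E c" "\<And>x. x \<in> topspace (spc X) \<Longrightarrow> p (c x) = b x"
proof -
  let ?\<Sigma> = "sum_topology (\<lambda>n. spc (S n)) UNIV"
  have k: "pmap (S n) (S (Suc n)) (k n)" and \<iota>: "pmap (S n) X (\<iota> n)" for n
    using col by (auto simp: is_seq_colimit_def)
  have q: "is_quotient_by ?\<Sigma> (seq_colimit_rel S k) (spc X) (\<lambda>(n, x). \<iota> n x)"
    using col by (simp add: is_seq_colimit_def)
  have \<iota>k: "\<iota> (Suc n) (k n x) = \<iota> n x" if "x \<in> topspace (spc (S n))" for n x
  proof -
    have "equivclp (seq_colimit_rel S k) (n, x) (Suc n, k n x)"
      using that by - (rule r_into_equivclp, auto simp: seq_colimit_rel_def)
    moreover have "(n, x) \<in> topspace ?\<Sigma>" "(Suc n, k n x) \<in> topspace ?\<Sigma>"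
      using that pmap_in[OF k] by auto
    ultimately have "(\<lambda>(n, x). \<iota> n x) (n, x) = (\<lambda>(n, x). \<iota> n x) (Suc n, k n x)"
      using q unfolding is_quotient_by_def by blast
    then show ?thesis by simp
  qed
  let ?P = "\<lambda>n c. pmap (S n) E c \<and> (\<forall>x\<in>topspace (spc (S n)). p (c x) = b (\<iota> n x))"
  let ?Q = "\<lambda>n c d. \<forall>x\<in>topspace (spc (S n)). d (k n x) = c x"
  have base: "?P 0 (\<lambda>_. bpt E)"
    using pmap_const[OF E] p b \<iota>[of 0] by (simp add: S0 pmap_def)
  have step: "\<exists>d. ?P (Suc n) d \<and> ?Q n c d" if c: "?P n c" for n c
  proof -
    have "b (\<iota> (Suc n) (k n x)) = p (c x)" if "x \<in> topspace (spc (S n))" for x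
      using c that \<iota>k by simp
    from liftsE[OF L[of n] _ pmap_comp[OF \<iota> b] this] c show ?thesis by metis
  qed
  obtain c where c: "\<And>n. ?P n (c n)" "\<And>n. ?Q n (c n) (c (Suc n))"
    \<comment> \<open>Each lift depends on the one chosen before it, hence dependent choice.\<close>
    using dependent_nat_choice[of ?P ?Q, OF exI[of "?P 0", OF base] step] by blast
  have "continuous_map ?\<Sigma> (spc E) (\<lambda>(n, x). c n x)"
    by (rule continuous_map_from_sum_topology) (use c(1) in \<open>auto simp: pmap_def\<close>)
  moreover have "(\<lambda>(n, x). c n x) y = (\<lambda>(n, x). c n x) y'" if "seq_colimit_rel S k y y'" for y y'
    using that c(2) by (auto simp: seq_colimit_rel_def)
  ultimately obtain d where d: "continuous_map (spc X) (spc E) d"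
    "\<forall>y\<in>topspace ?\<Sigma>. d (case y of (n, x) \<Rightarrow> \<iota> n x) = (case y of (n, x) \<Rightarrow> c n x)"
    using is_quotient_by_lift[OF q] by blast
  have d\<iota>: "d (\<iota> n x) = c n x" if "x \<in> topspace (spc (S n))" for n x
    using d(2)[rule_format, of "(n, x)"] that by simp
  have "d (bpt X) = bpt E"
    using d\<iota>[of "bpt (S 0)" 0] \<iota>[of 0] c(1)[of 0] by (simp add: S0 pmap_def)
  then have "pmap X E d" using d(1) by (simp add: pmap_def)
  moreover have "p (d x) = b x" if x: "x \<in> topspace (spc X)" for x
  proof -
    have "x \<in> (\<lambda>(n, x). \<iota> n x) ` topspace ?\<Sigma>"
      using q x by (simp add: is_quotient_by_def quotient_map_def)
    then obtain n y where "y \<in> topspace (spc (S n))" "x = \<iota> n y" by auto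
    then show ?thesis using d\<iota> c(1) by simp
  qed
  ultimately show thesis by (rule that)
qed

section \<open>Cones and suspensions\<close>

lemma to_unit_cylinder:
  "continuous_map (prod_topology X euclideanreal) (cylinder X) (\<lambda>z. (fst z, to_unit (snd z)))"
proof (rule continuous_map_pairedI)
  show "continuous_map (prod_topology X euclideanreal) (top_of_set {0..1}) (\<lambda>z. to_unit (snd z))"
    by (rule continuous_map_into_subtopology[OF continuous_map_to_unit[OF continuous_map_snd]]) auto
qed (rule continuous_map_fst)

lemma continuous_map_cylinder:
  assumes "continuous_map (prod_topology X euclideanreal) W u"
  shows "continuous_map (cylinder X) W u"
proof -
  have "continuous_map (cylinder X) (prod_topology X euclideanreal) (\<lambda>z. (fst z, snd z))"
    by (rule continuous_map_pairedI[OF continuous_map_fst continuous_map_into_fulltopology[OF continuous_map_snd]])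
  from continuous_map_comp[OF assms this] show ?thesis by simp
qed

lemma bpt_cone [simp]: "bpt (cone B) = Star"
  and bpt_susp [simp]: "bpt (susp B) = Star"
  by (simp_all add: cone_def susp_def)

lemma cone_proj_Star [simp]: "cone_proj B (bpt B, t) = Star" "cone_proj B (x, 1) = Star"
  by (simp_all add: cone_proj_def)

lemma susp_proj_Star [simp]:
  "susp_proj B (bpt B, t) = Star" "susp_proj B (x, 0) = Star" "susp_proj B (x, 1) = Star"
  by (simp_all add: susp_proj_def)

lemma quotient_map_cone: "quotient_map (cylinder (spc B)) (spc (cone B)) (cone_proj B)"
  unfolding cone_def fst_conv by (rule quotient_map_final_topology) (rule refl)

lemma quotient_map_susp: "quotient_map (cylinder (spc B)) (spc (susp B)) (susp_proj B)"
  unfolding susp_def fst_conv by (rule quotient_map_final_topology) (rule refl)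

lemma topspace_cone: "topspace (spc (cone B)) = cone_proj B ` (topspace (spc B) \<times> {0..1})"
  using quotient_map_cone[of B] by (simp add: quotient_map_def)

lemma topspace_susp: "topspace (spc (susp B)) = susp_proj B ` (topspace (spc B) \<times> {0..1})"
  using quotient_map_susp[of B] by (simp add: quotient_map_def)

lemma continuous_map_cone_proj:
  "continuous_map (prod_topology (spc B) euclideanreal) (spc (cone B)) (\<lambda>(x, t). cone_proj B (x, to_unit t))"
  using continuous_map_comp[OF quotient_imp_continuous_map[OF quotient_map_cone] to_unit_cylinder]
  by (simp add: case_prod_unfold)

lemma continuous_map_susp_proj:
  "continuous_map (prod_topology (spc B) euclideanreal) (spc (susp B)) (\<lambda>(x, t). susp_proj B (x, to_unit t))"
  using continuous_map_comp[OF quotient_imp_continuous_map[OF quotient_map_susp] to_unit_cylinder]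
  by (simp add: case_prod_unfold)

lemma pointed_space_susp: "pointed_space B \<Longrightarrow> pointed_space (susp B)"
  unfolding pointed_space_def bpt_susp topspace_susp
  by (rule image_eqI[of _ _ "(bpt B, 0)"]) auto

lemma pmap_cone_base: "pmap B (cone B) (cone_base B)"
  using continuous_map_compose_pair[OF continuous_map_cone_proj, of "spc B" B "\<lambda>x. x" "\<lambda>_. 0"]
  by (simp add: pmap_def cone_base_def[abs_def])

text \<open>The map is given over the whole line, to fit paths and clamped parameters, but is
  constrained only on the unit interval. It descends because distinct points of the cylinder are
  identified only when they go to \<open>Star\<close>.\<close>

lemma cone_universal:
  assumes B: "pointed_space B"
    and u: "continuous_map (prod_topology (spc B) euclideanreal) (spc E) (\<lambda>(x, t). u x t)"
    and 1: "\<And>x. x \<in> topspace (spc B) \<Longrightarrow> u x 1 = bpt E"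
    and bpt: "\<And>t. 0 \<le> t \<Longrightarrow> t \<le> 1 \<Longrightarrow> u (bpt B) t = bpt E"
  shows "\<exists>c. pmap (cone B) E c \<and>
    (\<forall>x\<in>topspace (spc B). \<forall>t\<in>{0..1}. c (cone_proj B (x, t)) = u x t)"
proof -
  obtain c where c: "continuous_map (spc (cone B)) (spc E) c"
    and cu: "\<And>z. z \<in> topspace (cylinder (spc B)) \<Longrightarrow> c (cone_proj B z) = (\<lambda>(x, t). u x t) z"
  proof (rule quotient_map_lift_exists[OF quotient_map_cone continuous_map_cylinder[OF u]])
    fix z w assume "z \<in> topspace (cylinder (spc B))" "w \<in> topspace (cylinder (spc B))"
      "cone_proj B z = cone_proj B w"
    then show "(\<lambda>(x, t). u x t) z = (\<lambda>(x, t). u x t) w"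
      using 1 bpt by (auto simp: cone_proj_def split: if_splits prod.splits)
  qed blast
  have "c (cone_proj B (x, t)) = u x t" if "x \<in> topspace (spc B)" "t \<in> {0..1}" for x t
    using cu[of "(x, t)"] that by simp
  moreover from this[of "bpt B" 1] have "c Star = bpt E"
    using B bpt by (simp add: pointed_space_def)
  ultimately show ?thesis using c by (auto simp: pmap_def)
qed

lemma susp_universal:
  assumes B: "pointed_space B"
    and u: "continuous_map (prod_topology (spc B) euclideanreal) (spc E) (\<lambda>(x, t). u x t)"
    and 0: "\<And>x. x \<in> topspace (spc B) \<Longrightarrow> u x 0 = bpt E"
    and 1: "\<And>x. x \<in> topspace (spc B) \<Longrightarrow> u x 1 = bpt E"
    and bpt: "\<And>t. 0 \<le> t \<Longrightarrow> t \<le> 1 \<Longrightarrow> u (bpt B) t = bpt E"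
  shows "\<exists>c. pmap (susp B) E c \<and>
    (\<forall>x\<in>topspace (spc B). \<forall>t\<in>{0..1}. c (susp_proj B (x, t)) = u x t)"
proof -
  obtain c where c: "continuous_map (spc (susp B)) (spc E) c"
    and cu: "\<And>z. z \<in> topspace (cylinder (spc B)) \<Longrightarrow> c (susp_proj B z) = (\<lambda>(x, t). u x t) z"
  proof (rule quotient_map_lift_exists[OF quotient_map_susp continuous_map_cylinder[OF u]])
    fix z w assume "z \<in> topspace (cylinder (spc B))" "w \<in> topspace (cylinder (spc B))"
      "susp_proj B z = susp_proj B w"
    then show "(\<lambda>(x, t). u x t) z = (\<lambda>(x, t). u x t) w"
      using 0 1 bpt by (auto simp: susp_proj_def split: if_splits prod.splits)
  qed blast
  have "c (susp_proj B (x, t)) = u x t" if "x \<in> topspace (spc B)" "t \<in> {0..1}" for x t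
    using cu[of "(x, t)"] that by simp
  moreover from this[of "bpt B" 1] have "c Star = bpt E"
    using B bpt by (simp add: pointed_space_def)
  ultimately show ?thesis using c by (auto simp: pmap_def)
qed


section \<open>Mapping path spaces\<close>

text \<open>Paths are required to be constant outside the unit interval, because a lift has to reproduce
  the given path on the whole line.\<close>

definition mapping_path :: "'x pointed \<Rightarrow> 'y pointed \<Rightarrow> ('x \<Rightarrow> 'y) \<Rightarrow> ('x \<times> (real \<Rightarrow> 'y)) pointed" where
  "mapping_path X Y f =
     (subtopology (prod_topology (spc X) (path_space (spc Y)))
        {(x, \<gamma>). \<gamma> 0 = f x \<and> (\<forall>t. \<gamma> (to_unit t) = \<gamma> t)}, (bpt X, \<lambda>_. bpt Y))"

definition path_end :: "'x \<times> (real \<Rightarrow> 'y) \<Rightarrow> 'y" where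
  "path_end e = snd e 1"

lemma pmap_mapping_path_fst: "pmap (mapping_path X Y f) X fst"
  unfolding pmap_def mapping_path_def
  using continuous_map_from_subtopology[OF continuous_map_fst] by simp

lemma pmap_mapping_path_snd: "pmap (mapping_path X Y f) (ppath Y) snd"
  unfolding pmap_def mapping_path_def ppath_def
  using continuous_map_from_subtopology[OF continuous_map_snd] by simp

lemma pmap_path_end: "pmap (mapping_path X Y f) Y path_end"
proof -
  have "continuous_map (spc (mapping_path X Y f)) (spc Y) (\<lambda>e. snd e 1)"
    using pmap_mapping_path_snd[of X Y f]
    by - (rule continuous_map_eval_comp, simp_all add: pmap_def ppath_def)
  then show ?thesis
    by (simp add: pmap_def path_end_def[abs_def]) (simp add: mapping_path_def)
qed

lemma mapping_path_start:
  "e \<in> topspace (spc (mapping_path X Y f)) \<Longrightarrow> snd e 0 = f (fst e)"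
  "e \<in> topspace (spc (mapping_path X Y f)) \<Longrightarrow> snd e (to_unit t) = snd e t"
  by (auto simp: mapping_path_def)

lemma pmap_into_mapping_path:
  assumes "pmap B X a" "pmap B (ppath Y) K"
    and "\<And>x. x \<in> topspace (spc B) \<Longrightarrow> K x 0 = f (a x)"
    and "\<And>x t. x \<in> topspace (spc B) \<Longrightarrow> K x (to_unit t) = K x t"
  shows "pmap B (mapping_path X Y f) (\<lambda>x. (a x, K x))"
  using assms unfolding pmap_def mapping_path_def ppath_def
  by (auto intro!: continuous_map_into_subtopology continuous_map_pairedI)

lemma pointed_space_mapping_path:
  assumes "pointed_space X" "pmap X Y f"
  shows "pointed_space (mapping_path X Y f)"
proof -
  have "bpt Y \<in> topspace (spc Y)"
    using pointed_space_target[OF assms(2,1)] by (simp add: pointed_space_def)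
  then show ?thesis
    using assms by (simp add: pointed_space_def mapping_path_def topspace_path_space pmap_def)
qed

text \<open>The path component of a lift is itself the homotopy: it starts at \<open>f\<close> of
  the first component and ends at \<open>b\<close>.\<close>

lemma phomotopic_of_lift:
  assumes B: "pointed_space B" and c: "pmap B (mapping_path X Y f) c"
    and b: "\<And>x. x \<in> topspace (spc B) \<Longrightarrow> path_end (c x) = b x"
  shows "phomotopic B Y (f \<circ> (fst \<circ> c)) b"
proof (rule phomotopicI[OF B])
  show "pmap B (ppath Y) (\<lambda>x. snd (c x))"
    by (rule pmap_comp[OF c pmap_mapping_path_snd])
qed (use mapping_path_start(1)[OF pmap_in[OF c]] b in \<open>simp_all add: path_end_def\<close>)

section \<open>Lifting against cone inclusions\<close>

lemma continuous_on_to_unit [continuous_intros]: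
  "continuous_on S g \<Longrightarrow> continuous_on S (\<lambda>x. to_unit (g x))"
  unfolding to_unit_def by (intro continuous_intros)

lemma continuous_map_snd_real:
  assumes "continuous_on UNIV \<phi>"
  shows "continuous_map (prod_topology X euclideanreal) euclideanreal (\<lambda>z. \<phi> (snd z))"
  by (rule continuous_map_comp[of euclideanreal]) (use assms in \<open>simp_all add: continuous_map_snd\<close>)

lemma continuous_map_snd2_real:
  assumes "continuous_on UNIV (\<lambda>(t, s). \<phi> t s)"
  shows "continuous_map (prod_topology (prod_topology X euclideanreal) euclideanreal) euclideanreal
    (\<lambda>z. \<phi> (snd (fst z)) (snd z))"
proof -
  have "continuous_map (prod_topology euclideanreal euclideanreal) euclideanreal (\<lambda>(t, s). \<phi> t s)"
    using assms by simp
  from continuous_map_compose_pair[OF this continuous_map_comp[OF continuous_map_snd continuous_map_fst]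
      continuous_map_snd]
  show ?thesis .
qed

lemma continuous_map_ppath_eval:
  assumes K: "pmap B (ppath Y) K" and \<phi>: "continuous_on UNIV \<phi>"
  shows "continuous_map (prod_topology (spc B) euclideanreal) (spc Y) (\<lambda>z. K (fst z) (\<phi> (snd z)))"
proof -
  have "continuous_map (spc B) (path_space (spc Y)) K"
    using K by (simp add: pmap_def ppath_def)
  from continuous_map_eval_comp[OF continuous_map_comp[OF this continuous_map_fst] continuous_map_snd_real[OF \<phi>]]
  show ?thesis .
qed

text \<open>Let \<open>H\<close> be the given homotopy on the base, from \<open>f \<circ> a\<close> to the restriction of \<open>b\<close>.
  Following \<open>H\<close> and then the cone \<open>b\<close> contracts \<open>f \<circ> a\<close>, so \<open>a\<close> has a contraction \<open>G\<close>. The reverse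
  of \<open>f \<circ> G\<close>, then \<open>H\<close>, then \<open>b\<close> form a map \<open>D\<close> on the suspension, and \<open>K\<close> is a homotopy from \<open>f \<circ> e\<close>
  to \<open>D\<close>. The lift on the cone is \<open>G\<close> followed by \<open>e\<close>.\<close>

lemma lifts_cone:
  fixes B :: "'a cyl pointed" and X :: "'x pointed" and Y :: "'y pointed"
  assumes B: "pointed_space B" and X: "pointed_space X" and f: "pmap X Y f"
    and ker: "\<And>u. pmap B X u \<Longrightarrow> phomotopic B Y (f \<circ> u) (\<lambda>_. bpt Y) \<Longrightarrow> phomotopic B X u (\<lambda>_. bpt X)"
    and surj: "\<And>d. pmap (susp B) Y d \<Longrightarrow> \<exists>e. pmap (susp B) X e \<and> phomotopic (susp B) Y (f \<circ> e) d"
  shows "lifts B (cone B) (cone_base B) (mapping_path X Y f) Y path_end"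
proof (rule liftsI)
  fix a b assume a: "pmap B (mapping_path X Y f) a" and b: "pmap (cone B) Y b"
    and ba: "\<And>x. x \<in> topspace (spc B) \<Longrightarrow> b (cone_base B x) = path_end (a x)"
  let ?BI = "prod_topology (spc B) euclideanreal"
  have f0: "f (bpt X) = bpt Y" using f by (simp add: pmap_def)
  have b0: "b Star = bpt Y" using b by (simp add: pmap_def)

  define H where "H x = snd (a x)" for x
  have H: "pmap B (ppath Y) H"
    using pmap_comp[OF a pmap_mapping_path_snd] by (simp add: H_def[abs_def])
  have H0: "H x 0 = f (fst (a x))" and Hu: "H x (to_unit s) = H x s"
    and H1: "H x 1 = b (cone_proj B (x, 0))" if "x \<in> topspace (spc B)" for x s
    using mapping_path_start[OF pmap_in[OF a that]] ba[OF that]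
    by (simp_all add: H_def path_end_def cone_base_def)
  have Hb: "H (bpt B) s = bpt Y" for s
    using H by (simp add: pmap_def ppath_def)
  have a1: "pmap B X (\<lambda>x. fst (a x))"
    by (rule pmap_comp[OF a pmap_mapping_path_fst])
  have bcont: "continuous_map ?BI (spc Y) (\<lambda>(x, t). b (cone_proj B (x, to_unit t)))"
    using continuous_map_comp[of _ _ b, OF _ continuous_map_cone_proj] b
    by (simp add: pmap_def case_prod_unfold)

  have "phomotopic B Y (\<lambda>x. f (fst (a x))) (\<lambda>x. b (cone_proj B (x, 0)))"
    by (rule phomotopicI[OF B H]) (simp_all add: H0 H1)
  moreover have "phomotopic B Y (\<lambda>x. b (cone_proj B (x, 0))) (\<lambda>_. bpt Y)"
  proof (rule phomotopicI[OF B])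
    show "pmap B (ppath Y) (\<lambda>x t. b (cone_proj B (x, to_unit t)))"
      using continuous_map_curry[OF bcont] by (simp add: pmap_def ppath_def b0)
  qed (simp_all add: b0)
  ultimately have "phomotopic B Y (f \<circ> (\<lambda>x. fst (a x))) (\<lambda>_. bpt Y)"
    unfolding o_def by (rule phomotopic_trans)
  then obtain G where G: "pmap B (ppath X) G" "\<And>x. G x 0 = fst (a x)" "\<And>x. G x 1 = bpt X"
    using phomotopicE[OF ker[OF a1]] by metis
  have Gb: "G (bpt B) t = bpt X" for t
    using G(1) by (simp add: pmap_def ppath_def)
  note Gcont = continuous_map_ppath_eval[OF G(1)]
  note Hcont = continuous_map_ppath_eval[OF H]

  \<comment> \<open>At the breakpoints 1/3 and 2/3 the rescaled parameters are 0 or 1, so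
    neighbouring pieces agree.\<close>
  have third: "1 - 3 * t = 0" "3 * t - 1 = 0" "3 * t = 1" if "t * 3 = 1" for t :: real
    using that by auto
  have third': "3 * t - 1 = 1" "3 * t - 2 = 0" if "t * 3 = 2" for t :: real
    using that by auto
  \<comment> \<open>The ends are \<open>f (G x 1)\<close> and the value of \<open>b\<close> at the
    vertex, both the base point, so \<open>D\<close> descends to the suspension.\<close>
  define D where "D x t =
    (if t \<le> 1/3 then f (G x (to_unit (1 - 3 * t)))
     else if t \<le> 2/3 then H x (to_unit (3 * t - 1))
     else b (cone_proj B (x, to_unit (3 * t - 2))))" for x t
  have "continuous_map ?BI (spc Y)
    (\<lambda>z. if snd z \<le> 1/3 then f (G (fst z) (to_unit (1 - 3 * snd z)))
     else if snd z \<le> 2/3 then H (fst z) (to_unit (3 * snd z - 1))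
     else b (cone_proj B (fst z, to_unit (3 * snd z - 2))))"
  proof (intro continuous_map_paste)
    show "continuous_map ?BI (spc Y) (\<lambda>z. f (G (fst z) (to_unit (1 - 3 * snd z))))"
      using f by - (rule continuous_map_comp[of _ _ f, OF _ Gcont], auto simp: pmap_def intro!: continuous_intros)
    show "continuous_map ?BI (spc Y) (\<lambda>z. H (fst z) (to_unit (3 * snd z - 1)))"
      by (rule Hcont) (intro continuous_intros)
    show "continuous_map ?BI (spc Y) (\<lambda>z. b (cone_proj B (fst z, to_unit (3 * snd z - 2))))"
      by (rule continuous_map_compose_pair[OF bcont continuous_map_fst continuous_map_snd_real])
         (intro continuous_intros)
  qed (auto simp: continuous_map_snd H0 H1 G third third')
  then have "continuous_map ?BI (spc Y) (\<lambda>(x, t). D x t)"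
    by (simp add: D_def case_prod_unfold)
  moreover have "D x 0 = bpt Y" "D x 1 = bpt Y" "D (bpt B) t = bpt Y" for x t
    by (simp_all add: D_def G Gb Hb f0 b0)
  ultimately obtain d where d: "pmap (susp B) Y d"
    and dD: "\<And>x t. x \<in> topspace (spc B) \<Longrightarrow> 0 \<le> t \<Longrightarrow> t \<le> 1 \<Longrightarrow> d (susp_proj B (x, t)) = D x t"
    using susp_universal[OF B, of Y D] by fastforce
  obtain e where e: "pmap (susp B) X e" and "phomotopic (susp B) Y (f \<circ> e) d"
    using surj[OF d] by blast
  then obtain K where K: "pmap (susp B) (ppath Y) K" "\<And>y. K y 0 = f (e y)" "\<And>y. K y 1 = d y"
    using phomotopicE by (metis o_apply)
  have Kb: "K Star = (\<lambda>_. bpt Y)" and eb: "e Star = bpt X"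
    using K(1) e by (simp_all add: pmap_def ppath_def)

  \<comment> \<open>For \<open>t\<close> between 1/3 and 2/3 the clamped parameter is 0 and
    \<open>U\<close> rests at the base point, after \<open>G\<close> has ended and before
    \<open>e\<close> starts. Meanwhile \<sigma> falls from 1 to 0 along the side \<tau> = 0 of the
    square of \<open>K\<close>.\<close>
  define U where "U x t =
    (if t \<le> 1/3 then G x (to_unit (3 * t)) else e (susp_proj B (x, to_unit (3 * t - 2))))" for x t
  text \<open>For fixed \<open>x\<close>, the homotopy on the cone is a square in \<open>(t, s)\<close> with prescribed boundary: \<open>H\<close> at
    \<open>t = 0\<close>, \<open>b\<close> at \<open>s = 1\<close>, constant at \<open>t = 1\<close>, and the image of the lift at \<open>s = 0\<close>. The map \<open>(\<tau>, \<sigma>)\<close> sends its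
    boundary to that of the square of \<open>K\<close>: the path from \<open>(1/3, 0)\<close> through \<open>(0, 0)\<close> and \<open>(0, 1)\<close> to \<open>(1, 1)\<close> goes to
    the side \<open>\<sigma> = 1\<close>, which carries \<open>D\<close>; the interval \<open>2/3 \<le> t\<close> of \<open>s = 0\<close> goes to \<open>\<sigma> = 0\<close>, which carries
    \<open>f \<circ> e\<close>; the rest goes to the sides on which \<open>K\<close> is constant.\<close>
  define \<tau> :: "real \<Rightarrow> real \<Rightarrow> real"
    where "\<tau> t s = (1 - s) * max (1/3 - t) (max 0 (3 * t - 2)) + s * (2 + t) / 3" for t s
  define \<sigma> :: "real \<Rightarrow> real \<Rightarrow> real" where "\<sigma> t s = min 1 (max s (2 - 3 * t))" for t s
  define W where "W x t s = K (susp_proj B (x, to_unit (\<tau> t (to_unit s)))) (\<sigma> t (to_unit s))" for x t s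

  have "continuous_map ?BI (spc X)
    (\<lambda>z. if snd z \<le> 1/3 then G (fst z) (to_unit (3 * snd z)) else e (susp_proj B (fst z, to_unit (3 * snd z - 2))))"
  proof (intro continuous_map_paste)
    show "continuous_map ?BI (spc X) (\<lambda>z. G (fst z) (to_unit (3 * snd z)))"
      by (rule Gcont) (intro continuous_intros)
    show "continuous_map ?BI (spc X) (\<lambda>z. e (susp_proj B (fst z, to_unit (3 * snd z - 2))))"
    proof (rule continuous_map_comp[where f = e and X = "spc (susp B)"])
      show "continuous_map ?BI (spc (susp B)) (\<lambda>z. susp_proj B (fst z, to_unit (3 * snd z - 2)))"
        by (rule continuous_map_compose_pair[OF continuous_map_susp_proj continuous_map_fst continuous_map_snd_real])
           (intro continuous_intros)
    qed (use e in \<open>simp add: pmap_def\<close>)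
  qed (auto simp: continuous_map_snd to_unit_le_0 G eb third)
  then have Ucont: "continuous_map ?BI (spc X) (\<lambda>(x, t). U x t)"
    by (simp add: U_def case_prod_unfold)
  \<comment> \<open>The second line factor is the path parameter \<open>s\<close>; currying the
    jointly continuous map gives paths that depend continuously on \<open>(x, t)\<close>.\<close>
  let ?BII = "prod_topology ?BI euclideanreal"
  have "continuous_map ?BII (spc Y)
    (\<lambda>z. K (susp_proj B (fst (fst z), to_unit (\<tau> (snd (fst z)) (to_unit (snd z))))) (\<sigma> (snd (fst z)) (to_unit (snd z))))"
  proof (rule continuous_map_eval_comp)
    show "continuous_map ?BII euclideanreal (\<lambda>z. \<sigma> (snd (fst z)) (to_unit (snd z)))"
      by (rule continuous_map_snd2_real)
         (simp add: \<sigma>_def case_prod_unfold, intro continuous_intros)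
    have "continuous_map ?BII (spc (susp B)) (\<lambda>z. susp_proj B (fst (fst z), to_unit (\<tau> (snd (fst z)) (to_unit (snd z)))))"
      by (rule continuous_map_compose_pair[OF continuous_map_susp_proj
            continuous_map_comp[OF continuous_map_fst continuous_map_fst] continuous_map_snd2_real])
         (simp add: \<tau>_def case_prod_unfold, intro continuous_intros, auto)
    then show "continuous_map ?BII (path_space (spc Y))
        (\<lambda>z. K (susp_proj B (fst (fst z), to_unit (\<tau> (snd (fst z)) (to_unit (snd z))))))"
      using K(1) by - (rule continuous_map_comp[where f = K and X = "spc (susp B)"], auto simp: pmap_def ppath_def)
  qed
  then have "continuous_map ?BII (spc Y) (\<lambda>(z, s). (\<lambda>(x, t). W x t) z s)"
    by (simp add: W_def case_prod_unfold)
  then have Wcont: "continuous_map ?BI (path_space (spc Y)) (\<lambda>(x, t). W x t)"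
    by (rule continuous_map_curry)

  have W0: "W x t 0 = f (U x t)" if x: "x \<in> topspace (spc B)" and t: "0 \<le> t" "t \<le> 1" for x t
  proof -
    consider "t \<le> 1/3" | "1/3 < t" "t \<le> 2/3" | "2/3 < t" by linarith
    then show ?thesis
    proof cases
      case 1
      then have "\<tau> t 0 = 1/3 - t" "\<sigma> t 0 = 1" by (auto simp: \<tau>_def \<sigma>_def)
      \<comment> \<open>Here \<tau> runs backwards and \<open>D\<close> traverses
        \<open>f \<circ> G\<close> backwards, so the reversals cancel.\<close>
      then have "W x t 0 = D x (1/3 - t)"
        using 1 t x by (simp add: W_def K dD)
      also have "\<dots> = f (G x (to_unit (1 - 3 * (1/3 - t))))"
        using t by (simp add: D_def)
      also have "1 - 3 * (1/3 - t) = 3 * t" by simp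
      finally show ?thesis using 1 by (simp add: U_def)
    next
      case 2
      then have "\<tau> t 0 = 0" by (auto simp: \<tau>_def)
      then show ?thesis using 2 t by (simp add: W_def U_def Kb f0 eb to_unit_le_0)
    next
      case 3
      then have "\<tau> t 0 = 3 * t - 2" "\<sigma> t 0 = 0" by (auto simp: \<tau>_def \<sigma>_def)
      then show ?thesis using 3 t by (simp add: W_def U_def K)
    qed
  qed
  have W1: "W x t 1 = b (cone_proj B (x, t))" if x: "x \<in> topspace (spc B)" and t: "0 \<le> t" "t \<le> 1" for x t
  proof -
    have "W x t 1 = D x ((2 + t) / 3)"
      using t x by (simp add: W_def \<tau>_def \<sigma>_def K dD)
    \<comment> \<open>For \<open>t = 0\<close> the argument is 2/3, which belongs to the
      \<open>H\<close> branch of \<open>D\<close>; there \<open>H1\<close> gives the value of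
      \<open>b\<close>.\<close>
    then show ?thesis using t x by (cases "t = 0") (simp_all add: D_def H1 field_simps)
  qed
  \<comment> \<open>Equality on the whole line is required, as the lift must return the point
    \<open>a x\<close> itself; \<open>Hu\<close> covers parameters outside the unit
    interval.\<close>
  have Wbase: "W x 0 = H x" if x: "x \<in> topspace (spc B)" for x
  proof
    fix s
    let ?s = "to_unit s"
    have bounds: "0 \<le> ?s" "?s \<le> 1" by simp_all
    have "\<tau> 0 ?s = (1 + ?s) / 3" by (simp add: \<tau>_def field_simps)
    moreover have "\<sigma> 0 ?s = 1" by (simp add: \<sigma>_def)
    moreover have "0 \<le> (1 + ?s) / 3" "(1 + ?s) / 3 \<le> 1" by (simp_all add: order_trans[OF to_unit_bounds(2)])
    ultimately have "W x 0 s = D x ((1 + ?s) / 3)"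
      unfolding W_def using x by (simp only: K dD to_unit_id)
    also have "\<dots> = H x ?s"
    \<comment> \<open>The argument runs through the middle third, but its left end 1/3 belongs to
      the first branch of \<open>D\<close>, where \<open>G x 0\<close> is the first component of
      \<open>a x\<close>.\<close>
    proof (cases "?s = 0")
      case True
      then show ?thesis using x by (simp add: D_def G H0)
    next
      case False
      then have "\<not> (1 + ?s) / 3 \<le> 1/3"
        using to_unit_bounds(1)[of s] by (auto simp del: to_unit_bounds)
      moreover have "(1 + ?s) / 3 \<le> 2/3" by simp
      moreover have "3 * ((1 + ?s) / 3) - 1 = ?s" by (simp add: add_divide_distrib)
      ultimately show ?thesis using bounds unfolding D_def by (simp only: if_True if_False to_unit_id)
    qed
    finally show "W x 0 s = H x s" using Hu[OF x] by simp
  qed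
  \<comment> \<open>At \<open>t = 1\<close> the coordinate \<tau> is identically 1, so
    \<open>K\<close> is evaluated at \<open>Star\<close>.\<close>
  have Wvertex: "W x 1 = (\<lambda>_. bpt Y)" for x
    by (simp add: fun_eq_iff W_def \<tau>_def Kb)

  \<comment> \<open>Clamping \<open>t\<close> keeps the pair in the mapping path space, because
    \<open>W0\<close> holds only for \<open>t\<close> in the unit interval.\<close>
  define V where "V x t = (U x (to_unit t), W x (to_unit t))" for x t
  have unit: "continuous_map ?BI euclideanreal (\<lambda>z. to_unit (snd z))"
    by (rule continuous_map_to_unit[OF continuous_map_snd])
  have "continuous_map ?BI (prod_topology (spc X) (path_space (spc Y)))
      (\<lambda>z. (U (fst z) (to_unit (snd z)), W (fst z) (to_unit (snd z))))"
    by (rule continuous_map_pairedI[OF continuous_map_compose_pair[OF Ucont continuous_map_fst unit]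
          continuous_map_compose_pair[OF Wcont continuous_map_fst unit]])
  moreover have "W x t (to_unit s) = W x t s" for x t s
    by (simp add: W_def)
  ultimately have "continuous_map ?BI (spc (mapping_path X Y f))
      (\<lambda>z. (U (fst z) (to_unit (snd z)), W (fst z) (to_unit (snd z))))"
    unfolding mapping_path_def fst_conv by (intro continuous_map_into_subtopology) (auto simp: W0)
  then have Vcont: "continuous_map ?BI (spc (mapping_path X Y f)) (\<lambda>(x, t). V x t)"
    by (simp add: V_def case_prod_unfold)
  have "V x 1 = bpt (mapping_path X Y f)" for x
    by (simp add: V_def mapping_path_def Wvertex U_def eb)
  moreover have "V (bpt B) t = bpt (mapping_path X Y f)" for t
    by (simp add: V_def mapping_path_def U_def eb Gb fun_eq_iff W_def Kb)
  ultimately obtain c where c: "pmap (cone B) (mapping_path X Y f) c"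
    "\<forall>x\<in>topspace (spc B). \<forall>t\<in>{0..1}. c (cone_proj B (x, t)) = V x t"
    using cone_universal[OF B Vcont] by blast
  then have cUW: "c (cone_proj B (x, t)) = (U x t, W x t)"
    if "x \<in> topspace (spc B)" "0 \<le> t" "t \<le> 1" for x t
    using that by (simp add: V_def)
  have "c (cone_base B x) = a x" if "x \<in> topspace (spc B)" for x
    using that by (simp add: cone_base_def cUW Wbase U_def G H_def)
  moreover have "path_end (c w) = b w" if "w \<in> topspace (spc (cone B))" for w
    using that unfolding topspace_cone by (auto simp: cUW path_end_def W1)
  ultimately show "\<exists>c. pmap (cone B) (mapping_path X Y f) c \<and>
      (\<forall>x\<in>topspace (spc B). c (cone_base B x) = a x) \<and>
      (\<forall>w\<in>topspace (spc (cone B)). path_end (c w) = b w)"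
    using c(1) by blast
qed

section \<open>Lifting against attached cells\<close>

lemma pmap_Emb: "pmap A (embed A) Emb"
  unfolding pmap_def embed_def by (simp add: continuous_map_final_topology)

lemma pmap_inv_Emb: "pmap (embed A) A (inv_into UNIV Emb)"
proof -
  have inv: "inv_into UNIV Emb (Emb a :: 'a cyl) = a" for a
    by (simp add: inv_f_f inj_def)
  have "continuous_map (spc (embed A)) (spc A) (inv_into UNIV Emb)"
    unfolding embed_def fst_conv
    by (rule continuous_map_from_final_topology) (auto simp: inv)
  then show ?thesis by (simp add: pmap_def embed_def inv)
qed

lemma pointed_space_Sigma_pow: "pointed_space A \<Longrightarrow> pointed_space (Sigma_pow n A)"
  by (induction n) (simp_all add: pointed_space_susp pointed_space_target[OF pmap_Emb])

text \<open>Degree 0 is formed with the copy \<open>embed A\<close>, so \<open>b\<close> is pulled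
  back to it, and the homotopy found there, carried back along \<open>Emb\<close>, becomes the path
  component. The condition on the point is automatic for pointed maps.\<close>

lemma lifts_point:
  assumes A: "pointed_space A" and f: "pmap X Y f"
    and surj: "\<And>d. pmap (embed A) Y d \<Longrightarrow> \<exists>e. pmap (embed A) X e \<and> phomotopic (embed A) Y (f \<circ> e) d"
  shows "lifts point_space A (\<lambda>_. bpt A) (mapping_path X Y f) Y path_end"
proof (rule liftsI)
  fix a b assume a: "pmap point_space (mapping_path X Y f) a" and b: "pmap A Y b"
  obtain e where e: "pmap (embed A) X e" "phomotopic (embed A) Y (f \<circ> e) (b \<circ> inv_into UNIV Emb)"
    using surj[OF pmap_compose[OF pmap_inv_Emb b]] by blast
  obtain K where K: "pmap (embed A) (ppath Y) K" "\<And>y. K y 0 = f (e y)" "\<And>y. K y 1 = b (inv_into UNIV Emb y)"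
    "\<And>y t. K y (to_unit t) = K y t"
    using phomotopicE[OF e(2)] unfolding o_apply by blast
  let ?c = "\<lambda>x. (e (Emb x), K (Emb x))"
  have c: "pmap A (mapping_path X Y f) ?c"
    by (rule pmap_into_mapping_path[OF pmap_comp[OF pmap_Emb e(1)] pmap_comp[OF pmap_Emb K(1)]])
       (simp_all add: K)
  moreover have "?c (bpt A) = a z" for z
    using a c by (simp add: pmap_def point_space_def)
  moreover have "path_end (?c w) = b w" for w
    by (simp add: path_end_def K inv_f_f inj_def)
  ultimately show "\<exists>c. pmap A (mapping_path X Y f) c \<and> (\<forall>z\<in>topspace (spc point_space). c (bpt A) = a z) \<and>
      (\<forall>w\<in>topspace (spc A). path_end (c w) = b w)"
    by (intro exI[of _ ?c]) simp
qed

lemma pointed_space_attach_cells: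
  assumes "attach_cells TJ n A Z X k" "pointed_space Z"
  shows "pointed_space X"
proof -
  have "pmap Z X k"
    using assms(1) by (auto simp: attach_cells_def is_pushout_def split: if_splits)
  then show ?thesis using assms(2) by (rule pointed_space_target)
qed

text \<open>Cells of dimension \<open>Suc m\<close> are cones on \<open>Sigma_pow m A\<close>: they
  use \<open>ker\<close> in degree \<open>m\<close> and \<open>surj\<close> in degree
  \<open>Suc m\<close>. Cells of dimension 0 use \<open>surj\<close> in degree 0.\<close>

lemma lifts_attach_cells:
  assumes A: "pointed_space A" and X: "pointed_space X" and f: "pmap X Y f"
    and ker: "\<And>r u. pmap (Sigma_pow r A) X u \<Longrightarrow> phomotopic (Sigma_pow r A) Y (f \<circ> u) (\<lambda>_. bpt Y) \<Longrightarrow>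
      phomotopic (Sigma_pow r A) X u (\<lambda>_. bpt X)"
    and surj: "\<And>r d. pmap (Sigma_pow r A) Y d \<Longrightarrow>
      \<exists>e. pmap (Sigma_pow r A) X e \<and> phomotopic (Sigma_pow r A) Y (f \<circ> e) d"
    and Z: "pointed_space Z" and W: "attach_cells TJ n A Z W k"
  shows "lifts Z W k (mapping_path X Y f) Y path_end"
proof (cases n)
  case 0
  have "lifts point_space A (\<lambda>_. bpt A) (mapping_path X Y f) Y path_end"
    using surj[of 0] by (intro lifts_point[OF A f]) simp
  note L = lifts_wedge_point[OF A pointed_space_mapping_path[OF X f] pmap_path_end this]
  show ?thesis
    using W 0 lifts_pushout[OF _ Z L] unfolding attach_cells_def by (simp only: if_True refl) blast
next
  case (Suc m)
  let ?B = "Sigma_pow m A"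
  have "lifts ?B (cone ?B) (cone_base ?B) (mapping_path X Y f) Y path_end"
    by (rule lifts_cone[OF pointed_space_Sigma_pow[OF A] X f ker]) (use surj[of "Suc m"] in simp_all)
  note L = lifts_wedge[OF pmap_cone_base pointed_space_mapping_path[OF X f] pmap_path_end this]
  show ?thesis
    using W Suc lifts_pushout[OF _ Z L] unfolding attach_cells_def by (simp only: if_False nat.simps diff_Suc_1) blast
qed


section \<open>Homotopy classes\<close>

definition pclass :: "'b pointed \<Rightarrow> 'x pointed \<Rightarrow> ('b \<Rightarrow> 'x) \<Rightarrow> ('b \<Rightarrow> 'x) set" where
  "pclass B X u = {v. phomotopic B X u v}"

lemma pclasses_eq: "pclasses B X = pclass B X ` {u. pmap B X u}"
  by (auto simp: pclasses_def quotient_def pclass_def Image_def)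

lemma pclass_eqI:
  assumes "phomotopic B X u v"
  shows "pclass B X u = pclass B X v"
  unfolding pclass_def using assms phomotopic_sym phomotopic_trans by blast

lemma pclass_eqD:
  assumes "pclass B X u = pclass B X v" "pmap B X v"
  shows "phomotopic B X u v"
  using assms(1) phomotopic_refl[OF assms(2)] by (auto simp: pclass_def)

lemma pclass_in: "pmap (Sigma_pow r A) X u \<Longrightarrow> pclass (Sigma_pow r A) X u \<in> pi_set r A X"
  by (simp add: pi_set_def pclasses_eq)

lemma pi_setE:
  assumes "C \<in> pi_set r A X"
  obtains u where "pmap (Sigma_pow r A) X u" "C = pclass (Sigma_pow r A) X u"
  using assms by (auto simp: pi_set_def pclasses_eq)

text \<open>\<open>pi_map\<close> collects the classes of \<open>f \<circ> u\<close> over all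
  representatives \<open>u\<close>; they coincide, so one representative suffices.\<close>

lemma pi_map_pclass:
  assumes f: "pmap X Y f" and u: "pmap (Sigma_pow r A) X u"
  shows "pi_map r A Y f (pclass (Sigma_pow r A) X u) = pclass (Sigma_pow r A) Y (f \<circ> u)"
  using phomotopic_trans phomotopic_compose_left[OF _ f] phomotopic_refl[OF u]
  unfolding pi_map_def pclass_def by blast

lemma pi_map_in:
  assumes f: "pmap X Y f" and C: "C \<in> pi_set r A X"
  shows "pi_map r A Y f C \<in> pi_set r A Y"
  using C by (rule pi_setE) (simp add: pi_map_pclass[OF f] pclass_in pmap_compose[OF _ f])

lemma pi_map_retract:
  assumes f: "pmap X Y f" and g: "pmap Y X g" and gf: "phomotopic X X (g \<circ> f) id" and C: "C \<in> pi_set r A X"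
  shows "pi_map r A X g (pi_map r A Y f C) = C"
proof -
  obtain u where u: "pmap (Sigma_pow r A) X u" "C = pclass (Sigma_pow r A) X u"
    using C by (rule pi_setE)
  have "phomotopic (Sigma_pow r A) X (g \<circ> (f \<circ> u)) u"
    using phomotopic_compose_right[OF gf u(1)] by (simp add: o_assoc)
  then show ?thesis
    using pclass_eqI by (simp add: u pi_map_pclass[OF f] pi_map_pclass[OF g] pmap_compose[OF _ f])
qed

section \<open>Maps bijective on all homotopy sets\<close>

definition pi_bijective :: "'a pointed \<Rightarrow> 'x pointed \<Rightarrow> 'y pointed \<Rightarrow> ('x \<Rightarrow> 'y) \<Rightarrow> bool" where
  "pi_bijective A X Y f \<longleftrightarrow> (\<forall>r. bij_betw (pi_map r A Y f) (pi_set r A X) (pi_set r A Y))"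

lemma pi_bijective_kernel:
  assumes "pi_bijective A X Y f" "pointed_space X" and f: "pmap X Y f" and u: "pmap (Sigma_pow r A) X u"
    and null: "phomotopic (Sigma_pow r A) Y (f \<circ> u) (\<lambda>_. bpt Y)"
  shows "phomotopic (Sigma_pow r A) X u (\<lambda>_. bpt X)"
proof -
  let ?B = "Sigma_pow r A"
  have const: "pmap ?B X (\<lambda>_. bpt X)" using assms(2) by (rule pmap_const)
  have f0: "f \<circ> (\<lambda>_. bpt X) = (\<lambda>_. bpt Y)" using f by (simp add: pmap_def fun_eq_iff)
  have "pi_map r A Y f (pclass ?B X u) = pi_map r A Y f (pclass ?B X (\<lambda>_. bpt X))"
    unfolding pi_map_pclass[OF f u] pi_map_pclass[OF f const] f0
    using null by (rule pclass_eqI)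
  moreover have "inj_on (pi_map r A Y f) (pi_set r A X)"
    using assms(1) by (auto simp: pi_bijective_def bij_betw_def)
  ultimately have "pclass ?B X u = pclass ?B X (\<lambda>_. bpt X)"
    using pclass_in[OF u] pclass_in[OF const] by (meson inj_onD)
  then show ?thesis using const by (rule pclass_eqD)
qed

lemma pi_bijective_surj:
  assumes "pi_bijective A X Y f" and f: "pmap X Y f" and d: "pmap (Sigma_pow r A) Y d"
  shows "\<exists>e. pmap (Sigma_pow r A) X e \<and> phomotopic (Sigma_pow r A) Y (f \<circ> e) d"
proof -
  have "pclass (Sigma_pow r A) Y d \<in> pi_map r A Y f ` pi_set r A X"
    using assms(1) pclass_in[OF d] by (simp add: pi_bijective_def bij_betw_def)
  then obtain e where e: "pmap (Sigma_pow r A) X e"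
    "pclass (Sigma_pow r A) Y d = pi_map r A Y f (pclass (Sigma_pow r A) X e)"
    by (auto elim: pi_setE)
  then show ?thesis
    using pclass_eqD[OF _ d] by (auto simp: pi_map_pclass[OF f])
qed

text \<open>The cells are those of the target \<open>Y\<close>, so the result can be applied again
  to the inverse, whose target is \<open>X\<close>.\<close>

lemma pi_bijective_right_inverse:
  fixes TS :: "'s itself"
  assumes A: "pointed_space A" and X: "pointed_space X" and Y: "CW_complex TJ TS A Y"
    and f: "pmap X Y f" and bij: "pi_bijective A X Y f"
  shows "\<exists>g. pmap Y X g \<and> phomotopic Y Y (f \<circ> g) id"
proof -
  let ?E = "mapping_path X Y f"
  obtain S :: "nat \<Rightarrow> 's pointed" and k \<iota> where S0: "topspace (spc (S 0)) = {bpt (S 0)}"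
    and att: "\<And>n. attach_cells TJ n A (S n) (S (Suc n)) (k n)" and col: "is_seq_colimit S k Y \<iota>"
    using Y unfolding CW_complex_def by blast
  have S: "pointed_space (S n)" for n
    using S0 pointed_space_attach_cells[OF att] by (induction n) (simp_all add: pointed_space_def)
  have "lifts (S n) (S (Suc n)) (k n) ?E Y path_end" for n
    by (rule lifts_attach_cells[OF A X f pi_bijective_kernel[OF bij X f] pi_bijective_surj[OF bij f] S att])
  then obtain c where c: "pmap Y ?E c" "\<And>y. y \<in> topspace (spc Y) \<Longrightarrow> path_end (c y) = id y"
    by (rule lifts_seq_colimit[OF col S0 pointed_space_mapping_path[OF X f] pmap_path_end, where b = id])
       (simp_all add: pmap_def)
  moreover have "pointed_space Y" using Y by (simp add: CW_complex_def)
  ultimately show ?thesis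
    using phomotopic_of_lift pmap_compose[OF c(1) pmap_mapping_path_fst] by blast
qed

text \<open>A right inverse of a bijection is its two-sided inverse, here for the maps induced on
  homotopy sets.\<close>

lemma pi_bijective_of_right_inverse:
  assumes f: "pmap X Y f" and g: "pmap Y X g" and fg: "phomotopic Y Y (f \<circ> g) id"
    and bij: "pi_bijective A X Y f"
  shows "pi_bijective A Y X g"
  unfolding pi_bijective_def
proof
  fix r
  have bij: "bij_betw (pi_map r A Y f) (pi_set r A X) (pi_set r A Y)"
    using bij by (simp add: pi_bijective_def)
  have fg: "pi_map r A Y f (pi_map r A X g D) = D" if "D \<in> pi_set r A Y" for D
    by (rule pi_map_retract[OF g f fg that])
  have "pi_map r A X g (pi_map r A Y f C) = C" if "C \<in> pi_set r A X" for C
  proof (rule inj_onD[OF bij_betw_imp_inj_on[OF bij]])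
    show "pi_map r A Y f (pi_map r A X g (pi_map r A Y f C)) = pi_map r A Y f C"
      using fg pi_map_in[OF f] that by blast
  qed (use that pi_map_in[OF f] pi_map_in[OF g] in blast)+
  then show "bij_betw (pi_map r A X g) (pi_set r A Y) (pi_set r A X)"
    using fg by - (rule bij_betw_byWitness[where f' = "pi_map r A Y f"], auto intro: pi_map_in[OF f] pi_map_in[OF g])
qed

lemma pi_bijective_imp_equivalence:
  assumes A: "pointed_space A" and X: "CW_complex TI TS A X" and Y: "CW_complex TJ TT A Y"
    and f: "pmap X Y f" and bij: "pi_bijective A X Y f"
  shows "phomotopy_equivalence X Y f"
proof -
  have pX: "pointed_space X" and pY: "pointed_space Y"
    using X Y by (simp_all add: CW_complex_def)
  obtain g where g: "pmap Y X g" "phomotopic Y Y (f \<circ> g) id"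
    using pi_bijective_right_inverse[OF A pX Y f bij] by blast
  obtain h where h: "pmap X Y h" "phomotopic X X (g \<circ> h) id"
    using pi_bijective_right_inverse[OF A pY X g(1) pi_bijective_of_right_inverse[OF f g bij]] by blast
  have gf: "pmap X X (g \<circ> f)" by (rule pmap_compose[OF f g(1)])
  \<comment> \<open>With \<open>h\<close> a right inverse of \<open>g\<close>, the chain is gf ~
    (gf)(gh) = g(fg)h ~ gh ~ id.\<close>
  have "phomotopic X X (g \<circ> f) ((g \<circ> f) \<circ> (g \<circ> h))"
    using phomotopic_sym[OF phomotopic_compose_left[OF h(2) gf]] by simp
  moreover have "phomotopic X X ((g \<circ> f) \<circ> (g \<circ> h)) (g \<circ> h)"
    using phomotopic_compose_left[OF phomotopic_compose_right[OF g(2) h(1)] g(1)] by (simp add: o_assoc)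
  ultimately have "phomotopic X X (g \<circ> f) id"
    using h(2) by (blast intro: phomotopic_trans)
  then show ?thesis
    using f g by (auto simp: phomotopy_equivalence_def)
qed


section \<open>Concatenation\<close>

text \<open>\<open>susp_concat\<close> inspects the representation of a point and sends
  \<open>Star\<close> to the base point. The formula also holds at collapsed points because
  \<open>u\<close> and \<open>v\<close> are pointed there.\<close>

lemma susp_concat_proj:
  assumes "u Star = bpt X" "v Star = bpt X" "0 \<le> t" "t \<le> 1"
  shows "susp_concat B X u v (susp_proj B (x, t)) =
    (if t \<le> 1/2 then u (susp_proj B (x, 2 * t)) else v (susp_proj B (x, 2 * t - 1)))"
  using assms by (auto simp: susp_concat_def susp_proj_def)

lemma pmap_susp_concat:
  assumes B: "pointed_space B" and u: "pmap (susp B) X u" and v: "pmap (susp B) X v"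
  shows "pmap (susp B) X (susp_concat B X u v)"
proof -
  let ?BI = "prod_topology (spc B) euclideanreal"
  have base: "u Star = bpt X" "v Star = bpt X"
    using u v by (simp_all add: pmap_def)
  have cont: "continuous_map ?BI (spc X) (\<lambda>z. w (susp_proj B (fst z, to_unit (\<phi> (snd z)))))"
    if w: "pmap (susp B) X w" and \<phi>: "continuous_on UNIV \<phi>" for w \<phi>
  proof (rule continuous_map_comp[where f = w and X = "spc (susp B)"])
    show "continuous_map ?BI (spc (susp B)) (\<lambda>z. susp_proj B (fst z, to_unit (\<phi> (snd z))))"
      by (rule continuous_map_compose_pair[OF continuous_map_susp_proj continuous_map_fst continuous_map_snd_real[OF \<phi>]])
  qed (use w in \<open>simp add: pmap_def\<close>)
  \<comment> \<open>Clamped version of the concatenation, continuous over the whole line; it agrees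
    with \<open>susp_concat\<close> only on the suspension, hence \<open>pmap_eq\<close> at the
    end.\<close>
  define w where "w x t =
    (if t \<le> 1/2 then u (susp_proj B (x, to_unit (2 * t))) else v (susp_proj B (x, to_unit (2 * t - 1))))" for x t
  have "continuous_map ?BI (spc X) (\<lambda>z. w (fst z) (snd z))"
    unfolding w_def
  proof (intro continuous_map_paste cont u v continuous_map_snd continuous_intros)
    have half: "2 * t = 1" "2 * t - 1 = 0" if "t = 1/2" for t :: real
      using that by auto
    show "u (susp_proj B (fst z, to_unit (2 * snd z))) = v (susp_proj B (fst z, to_unit (2 * snd z - 1)))"
      if "snd z = 1/2" for z
      by (simp only: half[OF that] base susp_proj_Star to_unit_id order_refl zero_le_one diff_self)
  qed
  then have "continuous_map ?BI (spc X) (\<lambda>(x, t). w x t)"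
    by (simp add: case_prod_unfold)
  moreover have "w x 0 = bpt X" "w x 1 = bpt X" "w (bpt B) t = bpt X" for x t
    by (simp_all add: w_def base)
  ultimately obtain c where c: "pmap (susp B) X c"
    "\<And>x t. x \<in> topspace (spc B) \<Longrightarrow> t \<in> {0..1} \<Longrightarrow> c (susp_proj B (x, t)) = w x t"
    using susp_universal[OF B, of X w] by fastforce
  have "c y = susp_concat B X u v y" if "y \<in> topspace (spc (susp B))" for y
    using that unfolding topspace_susp by (auto simp: c(2) w_def susp_concat_proj[of u X v, OF base])
  with c(1) pointed_space_susp[OF B] show ?thesis by (rule pmap_eq)
qed

text \<open>The homotopy is the concatenation of the two homotopies as maps into the path space.\<close>

lemma phomotopic_susp_concat:
  assumes B: "pointed_space B" and u: "phomotopic (susp B) X u u'" and v: "phomotopic (susp B) X v v'"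
  shows "phomotopic (susp B) X (susp_concat B X u v) (susp_concat B X u' v')"
proof -
  obtain K L where K: "pmap (susp B) (ppath X) K" "\<And>y. K y 0 = u y" "\<And>y. K y 1 = u' y"
    and L: "pmap (susp B) (ppath X) L" "\<And>y. L y 0 = v y" "\<And>y. L y 1 = v' y"
    using phomotopicE[OF u] phomotopicE[OF v] by metis
  show ?thesis
    by (rule phomotopicI[OF pointed_space_susp[OF B] pmap_susp_concat[OF B K(1) L(1)]])
       (auto simp: susp_concat_def ppath_def K L split: cyl.splits)
qed

lemma susp_concat_compose:
  assumes "pmap X Y f"
  shows "f \<circ> susp_concat B X u v = susp_concat B Y (f \<circ> u) (f \<circ> v)"
  using assms by (auto simp: fun_eq_iff susp_concat_def pmap_def split: cyl.splits)

text \<open>The product is defined through all representatives; invariance of concatenation under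
  homotopy reduces it to one pair.\<close>

lemma mult_susp_group:
  assumes B: "pointed_space B" and u: "pmap (susp B) X u" and v: "pmap (susp B) X v"
  shows "mult (susp_group B X) (pclass (susp B) X u) (pclass (susp B) X v) =
    pclass (susp B) X (susp_concat B X u v)"
proof -
  have "phomotopic (susp B) X (susp_concat B X u v) w"
    if "phomotopic (susp B) X u u'" "phomotopic (susp B) X v v'"
      "phomotopic (susp B) X (susp_concat B X u' v') w" for u' v' w
    using phomotopic_trans[OF phomotopic_susp_concat[OF B that(1,2)] that(3)] .
  then show ?thesis
    using phomotopic_refl[OF u] phomotopic_refl[OF v] by (auto simp: susp_group_def pclass_def)
qed

lemma pi_map_hom:
  assumes A: "pointed_space A" and f: "pmap X Y f" and r: "r \<ge> 1"
  shows "pi_map r A Y f \<in> hom (pi_group r A X) (pi_group r A Y)"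
proof (rule homI)
  fix C assume "C \<in> carrier (pi_group r A X)"
  then show "pi_map r A Y f C \<in> carrier (pi_group r A Y)"
    using pi_map_in[OF f, of C r A] r by (simp add: carrier_pi_group)
next
  fix C D assume "C \<in> carrier (pi_group r A X)" "D \<in> carrier (pi_group r A X)"
  then have CD: "C \<in> pi_set r A X" "D \<in> pi_set r A X"
    using r by (simp_all add: carrier_pi_group)
  obtain m where m: "r = Suc m" using r by (cases r) auto
  let ?B = "Sigma_pow m A"
  obtain u v where u: "pmap (susp ?B) X u" "C = pclass (susp ?B) X u"
    and v: "pmap (susp ?B) X v" "D = pclass (susp ?B) X v"
    using CD by (auto elim!: pi_setE simp: m)
  have B: "pointed_space ?B" using A by (rule pointed_space_Sigma_pow)
  have map: "pi_map (Suc m) A Y f (pclass (susp ?B) X w) = pclass (susp ?B) Y (f \<circ> w)"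
    if "pmap (susp ?B) X w" for w
    using pi_map_pclass[OF f, of "Suc m" A w] that by simp
  show "pi_map r A Y f (C \<otimes>\<^bsub>pi_group r A X\<^esub> D) =
      pi_map r A Y f C \<otimes>\<^bsub>pi_group r A Y\<^esub> pi_map r A Y f D"
    using u v pmap_compose[OF u(1) f] pmap_compose[OF v(1) f]
    by (simp add: m pi_group_def mult_susp_group[OF B] map pmap_susp_concat[OF B] susp_concat_compose[OF f])
qed

section \<open>Comparison with homotopy and weak equivalences\<close>

lemma pi_bijective_of_equivalence:
  assumes "phomotopy_equivalence X Y f"
  shows "pi_bijective A X Y f"
  unfolding pi_bijective_def
proof
  fix r
  obtain g where g: "pmap X Y f" "pmap Y X g" "phomotopic X X (g \<circ> f) id" "phomotopic Y Y (f \<circ> g) id"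
    using assms by (auto simp: phomotopy_equivalence_def)
  show "bij_betw (pi_map r A Y f) (pi_set r A X) (pi_set r A Y)"
    by (rule bij_betw_byWitness[where f' = "pi_map r A X g"])
       (use g in \<open>auto simp: pi_map_retract intro: pi_map_in\<close>)
qed

lemma A_weak_equivalence_iff:
  assumes A: "pointed_space A" and f: "pmap X Y f"
  shows "A_weak_equivalence A X Y f \<longleftrightarrow> pi_bijective A X Y f"
proof
  assume w: "A_weak_equivalence A X Y f"
  show "pi_bijective A X Y f"
    unfolding pi_bijective_def
  proof
    fix r
    \<comment> \<open>In an \<open>n\<close>-equivalence, degrees strictly below \<open>n\<close>
      are bijective, so degree \<open>r\<close> is read off at \<open>n = Suc r\<close>.\<close>
    have "A_n_equivalence (Suc r) A X Y f"
      using w by (simp add: A_weak_equivalence_def)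
    then show "bij_betw (pi_map r A Y f) (pi_set r A X) (pi_set r A Y)"
      by (cases "r = 0") (auto simp: A_n_equivalence_def iso_def carrier_pi_group)
  qed
next
  assume bij: "pi_bijective A X Y f"
  have iso: "pi_map r A Y f \<in> iso (pi_group r A X) (pi_group r A Y)" if "r \<ge> 1" for r
    using pi_map_hom[OF A f that] bij that by (auto simp: pi_bijective_def iso_def carrier_pi_group)
  then show "A_weak_equivalence A X Y f"
    using bij by (auto simp: A_weak_equivalence_def A_n_equivalence_def pi_bijective_def iso_iff_mon_epi)
qed

theorem theorem1p3:
  fixes A :: "'a pointed" and X :: "'x pointed" and Y :: "'y pointed" and f :: "'x \<Rightarrow> 'y"
  assumes "pointed_space A"
    and "CW_complex TYPE('i) TYPE('s) A X"
    and "CW_complex TYPE('j) TYPE('t) A Y"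
    and "pmap X Y f"
  shows "phomotopy_equivalence X Y f \<longleftrightarrow> A_weak_equivalence A X Y f"
  using pi_bijective_imp_equivalence[OF assms] pi_bijective_of_equivalence
    A_weak_equivalence_iff[OF assms(1,4)] by blast

end
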